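(* Let $n$ and $\delta$ be positive integers with $2n/3<\delta\le 3n/4$, and write $\delta=(1-\beta)n$ (so $1/4\le\beta<1/3$, $p=3$). Then $k_r(n,\delta)\ge g_r(\beta)n^r$ for every positive integer $r$. Moreover, for $r\in\{3,4\}$, equality $k_r(n,\delta)=g_r(\beta)n^r$ holds if and only if $(n,\beta)$ is feasible, and in that case a graph $G$ of order $n$ with minimum degree $\delta$ satisfies $k_r(G)=g_r(\beta)n^r$ if and only if $G\in\mathcal{G}(n,\beta)$.
   Context: All graphs are finite and simple; $k_r(G)$ is the number of $r$-cliques of $G$, and $k_r(n,\delta)$ is the minimum of $k_r(G)$ over all graphs $G$ of order $n$ with minimum degree $\delta$. Throughout, $\delta=(1-\beta)n$ with $0<\beta<1$, and $p=\lceil \beta^{-1}\rceil-1$, so $1/(p+1)\le \beta<1/p$. For such $\beta$ and integers $r$, define $$g_r(\beta)=\binom{p-1}{r}\beta^{r}+\binom{p-1}{r-1}(1-(p-1)\beta)\beta^{r-1}+\frac12\binom{p-1}{r-2}(1-p\beta)(1-(p-1)\beta)\beta^{r-2},$$ where $\binom{x}{y}=0$ if $x<y$ or $y<0$. The family $\mathcal{G}(n,\beta)$ (defined only when $n$ and $(1-\beta)n$ are positive integers not both odd) consists of all graphs $G$ on vertex set $V$, $|V|=n$, admitting a partition $V=V_0\cup V_1\cup\dots\cup V_{p-1}$ with $|V_0|=(1-(p-1)\beta)n$ and $|V_i|=\beta n$ for $1\le i\le p-1$, such that: all edges between $V_i$ and $V_j$ are present for $0\le i<j\le p-1$; $V_i$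 is independent for $1\le i\le p-1$; and $G[V_0]$ is $(1-p\beta)n$-regular with minimum number of triangles among all $(1-p\beta)n$-regular graphs on $|V_0|$ vertices. The pair $(n,\beta)$ is feasible if $\mathcal{G}(n,\beta)$ is defined and $G[V_0]$ is triangle-free for $G\in\mathcal{G}(n,\beta)$. *)

theory Defs
  imports Complex_Main
begin

definition simple_graph :: "'a set \<Rightarrow> ('a \<Rightarrow> 'a \<Rightarrow> bool) \<Rightarrow> bool" where
  "simple_graph V E \<longleftrightarrow> finite V \<and> (\<forall>x y. E x y \<longrightarrow> x \<in> V \<and> y \<in> V)
     \<and> (\<forall>x y. E x y \<longrightarrow> E y x) \<and> (\<forall>x. \<not> E x x)"

definition degree :: "'a set \<Rightarrow> ('a \<Rightarrow> 'a \<Rightarrow> bool) \<Rightarrow> 'a \<Rightarrow> nat" where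
  "degree V E v = card {u \<in> V. E v u}"

definition has_min_degree :: "'a set \<Rightarrow> ('a \<Rightarrow> 'a \<Rightarrow> bool) \<Rightarrow> nat \<Rightarrow> bool" where
  "has_min_degree V E d \<longleftrightarrow> (\<forall>v\<in>V. d \<le> degree V E v) \<and> (\<exists>v\<in>V. degree V E v = d)"

text \<open>Number of r-cliques of the graph (V, E) (for a subset V, counts cliques of G[V]).\<close>
definition clique_count :: "nat \<Rightarrow> 'a set \<Rightarrow> ('a \<Rightarrow> 'a \<Rightarrow> bool) \<Rightarrow> nat" where
  "clique_count r V E = card {S. S \<subseteq> V \<and> card S = r \<and> (\<forall>x\<in>S. \<forall>y\<in>S. x \<noteq> y \<longrightarrow> E x y)}"

text \<open>k_r(n,\<delta>): minimum number of r-cliques over graphs of order n with minimum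
  degree \<delta> (vertex set {0..<n}, which is no loss since everything is
  isomorphism-invariant).\<close>
definition kmin :: "nat \<Rightarrow> nat \<Rightarrow> nat \<Rightarrow> nat" where
  "kmin r n \<delta> = Min {clique_count r {0..<n} E | E.
      simple_graph {0..<n} E \<and> has_min_degree {0..<n} E \<delta>}"

definition binom :: "int \<Rightarrow> int \<Rightarrow> real" where
  "binom x y = (if y < 0 \<or> x < y then 0 else real (nat x choose nat y))"

definition pp :: "real \<Rightarrow> int" where
  "pp \<beta> = \<lceil>1 / \<beta>\<rceil> - 1"

definition g :: "nat \<Rightarrow> real \<Rightarrow> real" where
  "g r \<beta> = (let p = pp \<beta>; r' = int r in
      binom (p - 1) r' * \<beta> ^ r
    + binom (p - 1) (r' - 1) * (1 - of_int (p - 1) * \<beta>) * \<beta> ^ (r - 1)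
    + 1/2 * binom (p - 1) (r' - 2) * (1 - of_int p * \<beta>) * (1 - of_int (p - 1) * \<beta>) * \<beta> ^ (r - 2))"

definition min_tri_regular :: "nat \<Rightarrow> real \<Rightarrow> nat" where
  "min_tri_regular m d = Min {clique_count 3 {0..<m} E | E.
      simple_graph {0..<m} E \<and> (\<forall>v\<in>{0..<m}. real (degree {0..<m} E v) = d)}"

definition family_defined :: "nat \<Rightarrow> real \<Rightarrow> bool" where
  "family_defined n \<beta> \<longleftrightarrow> 0 < n \<and>
     (\<exists>d::nat. 0 < d \<and> real d = (1 - \<beta>) * real n \<and> \<not> (odd n \<and> odd d))"

text \<open>part assigns to each vertex its class index i (V_i = {v. part v = i}), i < p.\<close>
definition family_partition :: "nat \<Rightarrow> real \<Rightarrow> 'a set \<Rightarrow> ('a \<Rightarrow> 'a \<Rightarrow> bool) \<Rightarrow> ('a \<Rightarrow> nat) \<Rightarrow> bool" where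
  "family_partition n \<beta> V E part \<longleftrightarrow>
     (let p = pp \<beta>; V0 = {v \<in> V. part v = 0} in
       (\<forall>v\<in>V. int (part v) < p)
     \<and> real (card V0) = (1 - of_int (p - 1) * \<beta>) * real n
     \<and> (\<forall>i. 1 \<le> int i \<and> int i \<le> p - 1 \<longrightarrow> real (card {v \<in> V. part v = i}) = \<beta> * real n)
     \<and> (\<forall>u\<in>V. \<forall>v\<in>V. part u \<noteq> part v \<longrightarrow> E u v)
     \<and> (\<forall>u\<in>V. \<forall>v\<in>V. part u = part v \<and> 1 \<le> part u \<longrightarrow> \<not> E u v)
     \<and> (\<forall>v\<in>V0. real (degree V0 E v) = (1 - of_int p * \<beta>) * real n)
     \<and> clique_count 3 V0 E = min_tri_regular (card V0) ((1 - of_int p * \<beta>) * real n))"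

definition in_family :: "nat \<Rightarrow> real \<Rightarrow> 'a set \<Rightarrow> ('a \<Rightarrow> 'a \<Rightarrow> bool) \<Rightarrow> bool" where
  "in_family n \<beta> V E \<longleftrightarrow> family_defined n \<beta> \<and> simple_graph V E \<and> card V = n \<and>
     (\<exists>part. family_partition n \<beta> V E part)"

definition feasible :: "nat \<Rightarrow> real \<Rightarrow> bool" where
  "feasible n \<beta> \<longleftrightarrow> family_defined n \<beta> \<and>
     (\<forall>(E :: nat \<Rightarrow> nat \<Rightarrow> bool) part. simple_graph {0..<n} E \<and> family_partition n \<beta> {0..<n} E part
        \<longrightarrow> clique_count 3 {v \<in> {0..<n}. part v = 0} E = 0)"

end

theory Submission
  imports Defs
begin

text \<open>Put \<open>b = n - \<delta>\<close> and \<open>e = 3\<delta> - 2n\<close>, so \<open>n = 3b + e\<close>, \<open>\<delta> = 2b + e\<close> and \<open>0 < e \<le> b\<close>; the claims become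
  \<open>k\<^sub>3 \<ge> b(b+e)\<^sup>2\<close> and \<open>2k\<^sub>4 \<ge> b\<^sup>2(b+e)e\<close>.

  Triangles: the pairs (triangle \<open>T\<close>, vertex \<open>w\<close> adjacent to some vertex of \<open>T\<close>) are equinumerous with
  the pairs (vertex \<open>a\<close>, non-independent triple in \<open>N(a)\<close>). There are at most \<open>n k\<^sub>3\<close> of the former, and
  a \<open>\<delta>\<close>-subset of \<open>N(a)\<close> has few independent triples by Chase's theorem on triangles in graphs of
  bounded degree, applied to the complement. The same duality, applied to the complement, proves
  Chase's theorem. With ordered triples and loops allowed in the complement there are no
  lower-order terms, and the bound is exact. In the case of equality every vertex has a neighbour in
  every triangle and all codegrees of edges are \<open>b + e\<close> or \<open>2b\<close>; counting around a 4-clique produces an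
  edge of codegree \<open>2b\<close>, whose common neighbourhood consists of the two independent classes.

  4-cliques: capping the codegree \<open>D(T)\<close> of triangles at \<open>b\<close>, the four triangles of a 4-clique have
  capped codegrees summing to at least \<open>2(b+e)\<close>, while \<open>D min(D,b) \<le> (b+e)D - be\<close>; hence
  \<open>2(b+e)k\<^sub>4 \<ge> be k\<^sub>3\<close>.\<close>

subsection \<open>Triangle duality\<close>

text \<open>For a reflexive \<open>R\<close> and \<open>v\<close> in \<open>V\<close> the set
  contains \<open>v\<close>. One definition thus serves as open neighbourhood for adjacency and as
  closed neighbourhood for non-adjacency.\<close>

definition nbr :: "('a \<Rightarrow> 'a \<Rightarrow> bool) \<Rightarrow> 'a set \<Rightarrow> 'a \<Rightarrow> 'a set" where
  "nbr R V v = {u \<in> V. R v u}"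

text \<open>Triples are ordered and may repeat entries. For a symmetric irreflexive \<open>R\<close>
  this is six times the number of triangles; for a reflexive \<open>R\<close> a clique on
  \<open>s\<close> vertices contributes exactly \<open>s ^ 3\<close>, with no lower-order
  terms.\<close>

definition tri :: "('a \<Rightarrow> 'a \<Rightarrow> bool) \<Rightarrow> 'a set \<Rightarrow> int" where
  "tri R U = (\<Sum>x\<in>U. \<Sum>y\<in>U. \<Sum>z\<in>U. of_bool (R x y \<and> R y z \<and> R x z))"

lemma tri_nonneg: "0 \<le> tri R U"
  unfolding tri_def by (intro sum_nonneg) auto

lemma sum_filter_of_bool:
  fixes f :: "'a \<Rightarrow> int"
  assumes "finite V"
  shows "(\<Sum>x\<in>{u \<in> V. P u}. f x) = (\<Sum>x\<in>V. of_bool (P x) * f x)"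
  by (subst sum.inter_filter[OF assms]) (auto intro!: sum.cong)

lemma tri_filter:
  assumes "finite V"
  shows "tri R {u \<in> V. P u} =
    (\<Sum>x\<in>V. \<Sum>y\<in>V. \<Sum>z\<in>V. of_bool (P x \<and> P y \<and> P z) * of_bool (R x y \<and> R y z \<and> R x z))"
  unfolding tri_def sum_filter_of_bool[OF assms] sum_distrib_left
  by (intro sum.cong refl) auto

lemma card_filter_cube:
  assumes "finite V"
  shows "int (card {u \<in> V. P u}) ^ 3 = (\<Sum>x\<in>V. \<Sum>y\<in>V. \<Sum>z\<in>V. of_bool (P x \<and> P y \<and> P z))"
proof -
  have c: "int (card {u \<in> V. P u}) = (\<Sum>x\<in>V. of_bool (P x))"
    using sum_filter_of_bool[OF assms, where P=P and f="\<lambda>_. 1"] by simp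
  have "(\<Sum>x\<in>V. \<Sum>y\<in>V. \<Sum>z\<in>V. of_bool (P x \<and> P y \<and> P z) :: int) =
      (\<Sum>x\<in>V. of_bool (P x) * (\<Sum>y\<in>V. of_bool (P y) * (\<Sum>z\<in>V. of_bool (P z))))"
    unfolding sum_distrib_left by (intro sum.cong refl) auto
  also have "\<dots> = (\<Sum>x\<in>V. of_bool (P x)) ^ 3"
    by (simp add: sum_distrib_right[symmetric] power3_eq_cube mult_ac)
  finally show ?thesis unfolding c ..
qed

text \<open>The three adjacent transpositions generate all renamings of four summation variables, so
  they identify the counts of isomorphic labelled patterns.\<close>

lemma sum4_swap12:
  "(\<Sum>w\<in>V. \<Sum>x\<in>V. \<Sum>y\<in>V. \<Sum>z\<in>V. f w x y z) = (\<Sum>w\<in>V. \<Sum>x\<in>V. \<Sum>y\<in>V. \<Sum>z\<in>V. f x w y z)"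
  by (rule sum.swap)

lemma sum4_swap23:
  "(\<Sum>w\<in>V. \<Sum>x\<in>V. \<Sum>y\<in>V. \<Sum>z\<in>V. f w x y z) = (\<Sum>w\<in>V. \<Sum>x\<in>V. \<Sum>y\<in>V. \<Sum>z\<in>V. f w y x z)"
  by (intro sum.cong refl sum.swap)

lemma sum4_swap34:
  "(\<Sum>w\<in>V. \<Sum>x\<in>V. \<Sum>y\<in>V. \<Sum>z\<in>V. f w x y z) = (\<Sum>w\<in>V. \<Sum>x\<in>V. \<Sum>y\<in>V. \<Sum>z\<in>V. f w x z y)"
  by (intro sum.cong refl sum.swap)

text \<open>Inclusion-exclusion expands both sides into the same pattern counts. On the left a
  pattern is a triangle with one, two or three edges to \<open>w\<close>; on the right it is the
  three edges at \<open>w\<close> with one, two or three edges inside the triple. \<open>R\<close>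
  may have loops, so the identity serves adjacency and non-adjacency alike.\<close>

lemma triangle_duality:
  assumes V: "finite V" and sym: "\<And>x y. R x y \<Longrightarrow> R y x"
  shows "(\<Sum>w\<in>V. tri R V - tri R (V - nbr R V w)) =
         (\<Sum>w\<in>V. int (card (nbr R V w)) ^ 3 - tri (\<lambda>x y. \<not> R x y) (nbr R V w))"
proof -
  define a where "a x y = (of_bool (R x y) :: int)" for x y
  have as: "a x y = a y x" for x y
    using sym unfolding a_def by (metis of_bool_eq_iff)
  define S where "S f = (\<Sum>w\<in>V. \<Sum>x\<in>V. \<Sum>y\<in>V. \<Sum>z\<in>V. f w x y z)" for f :: "'a \<Rightarrow> 'a \<Rightarrow> 'a \<Rightarrow> 'a \<Rightarrow> int"
  have s12: "S f = S (\<lambda>w x y z. f x w y z)" for f unfolding S_def by (rule sum4_swap12)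
  have s23: "S f = S (\<lambda>w x y z. f w y x z)" for f unfolding S_def by (rule sum4_swap23)
  have s34: "S f = S (\<lambda>w x y z. f w x z y)" for f unfolding S_def by (rule sum4_swap34)
  have Sadd: "S (\<lambda>w x y z. f w x y z + g w x y z) = S f + S g"
    and Sdiff: "S (\<lambda>w x y z. f w x y z - g w x y z) = S f - S g" for f g
    unfolding S_def by (simp_all add: sum.distrib sum_subtractf)
  \<comment> \<open>The patterns are a triangle with a pendant edge, \<open>K_4\<close> minus an
    edge, and \<open>K_4\<close>.\<close>
  define A where "A = S (\<lambda>w x y z. a x y * a y z * a x z * a w x)"
  define B where "B = S (\<lambda>w x y z. a x y * a y z * a x z * a w x * a w y)"
  define C where "C = S (\<lambda>w x y z. a x y * a y z * a x z * a w x * a w y * a w z)"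
  have A2: "S (\<lambda>w x y z. a x y * a y z * a x z * a w y) = A"
    unfolding A_def by (subst s23) (simp add: as mult_ac)
  have A3: "S (\<lambda>w x y z. a x y * a y z * a x z * a w z) = A"
    unfolding A2[symmetric] by (subst s34) (simp add: as mult_ac)
  have B2: "S (\<lambda>w x y z. a x y * a y z * a x z * a w x * a w z) = B"
    unfolding B_def by (subst s34) (simp add: as mult_ac)
  have B3: "S (\<lambda>w x y z. a x y * a y z * a x z * a w y * a w z) = B"
    unfolding B2[symmetric] by (subst s23) (simp add: as mult_ac)
  have L: "(\<Sum>w\<in>V. tri R V - tri R (V - nbr R V w)) = 3 * A - 3 * B + C"
  proof -
    have eq: "V - nbr R V w = {u \<in> V. \<not> R w u}" for w unfolding nbr_def by auto
    \<comment> \<open>Termwise, the triangle indicator is multiplied by the expansion of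
      \<open>1 - (1 - a w x) * (1 - a w y) * (1 - a w z)\<close>.\<close>
    have "(\<Sum>w\<in>V. tri R V - tri R (V - nbr R V w)) =
      S (\<lambda>w x y z. a x y * a y z * a x z * a w x + a x y * a y z * a x z * a w y + a x y * a y z * a x z * a w z
         - a x y * a y z * a x z * a w x * a w y - a x y * a y z * a x z * a w x * a w z
         - a x y * a y z * a x z * a w y * a w z + a x y * a y z * a x z * a w x * a w y * a w z)"
      unfolding eq tri_filter[OF V] S_def
      unfolding tri_def sum_subtractf[symmetric] a_def
      by (intro sum.cong refl) auto
    also have "\<dots> = A + A + A - B - B - B + C"
      unfolding Sadd Sdiff A2 A3 B2 B3 A_def[symmetric] B_def[symmetric] C_def[symmetric] ..
    finally show ?thesis by simp
  qed
  \<comment> \<open>Here \<open>w\<close> is the vertex of degree three in the first pattern: the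
    triangle is \<open>w\<close>, \<open>x\<close>, \<open>y\<close>, and \<open>z\<close> is the
    pendant vertex at \<open>w\<close>.\<close>
  have A1': "S (\<lambda>w x y z. a w x * a w y * a w z * a x y) = A"
    unfolding A_def by (subst s34, subst s23, subst s12) (simp add: as mult_ac)
  have A2': "S (\<lambda>w x y z. a w x * a w y * a w z * a y z) = A"
    unfolding A_def by (subst s12) (simp add: as mult_ac)
  have A3': "S (\<lambda>w x y z. a w x * a w y * a w z * a x z) = A"
    unfolding A2'[symmetric] by (subst s23) (simp add: as mult_ac)
  have B1': "S (\<lambda>w x y z. a w x * a w y * a w z * a x y * a y z) = B"
    unfolding B_def by (subst s12) (simp add: as mult_ac)
  have B2': "S (\<lambda>w x y z. a w x * a w y * a w z * a x y * a x z) = B"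
    unfolding B1'[symmetric] by (subst s23) (simp add: as mult_ac)
  have B3': "S (\<lambda>w x y z. a w x * a w y * a w z * a y z * a x z) = B"
    unfolding B1'[symmetric] by (subst s34) (simp add: as mult_ac)
  have C': "S (\<lambda>w x y z. a w x * a w y * a w z * a x y * a y z * a x z) = C"
    unfolding C_def by (simp add: as mult_ac)
  have R: "(\<Sum>w\<in>V. int (card (nbr R V w)) ^ 3 - tri (\<lambda>x y. \<not> R x y) (nbr R V w)) = 3 * A - 3 * B + C"
  proof -
    have "(\<Sum>w\<in>V. int (card (nbr R V w)) ^ 3 - tri (\<lambda>x y. \<not> R x y) (nbr R V w)) =
      S (\<lambda>w x y z. a w x * a w y * a w z * a x y + a w x * a w y * a w z * a y z + a w x * a w y * a w z * a x z
        - a w x * a w y * a w z * a x y * a y z - a w x * a w y * a w z * a x y * a x z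
        - a w x * a w y * a w z * a y z * a x z + a w x * a w y * a w z * a x y * a y z * a x z)"
      unfolding nbr_def tri_filter[OF V] card_filter_cube[OF V] S_def
      unfolding sum_subtractf[symmetric] a_def
      by (intro sum.cong refl) auto
    also have "\<dots> = A + A + A - B - B - B + C"
      unfolding Sadd Sdiff A1' A2' A3' B1' B2' B3' C' ..
    finally show ?thesis by simp
  qed
  show ?thesis unfolding L R ..
qed

subsection \<open>Triangles in graphs of bounded degree\<close>

lemma tri_full:
  assumes "finite U" "tri R U = int (card U) ^ 3" "x \<in> U" "y \<in> U"
  shows "R x y"
proof (rule ccontr)
  assume "\<not> R x y"
  have "tri R U < (\<Sum>x\<in>U. \<Sum>y\<in>U. \<Sum>z\<in>U. 1 :: int)"
    unfolding tri_def
  proof (rule sum_strict_mono_ex1[OF assms(1)])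
    show "\<forall>x\<in>U. (\<Sum>y\<in>U. \<Sum>z\<in>U. of_bool (R x y \<and> R y z \<and> R x z)) \<le> (\<Sum>y\<in>U. \<Sum>z\<in>U. 1 :: int)"
      by (intro ballI sum_mono) auto
    have "(\<Sum>y\<in>U. \<Sum>z\<in>U. of_bool (R x y \<and> R y z \<and> R x z)) < (\<Sum>y\<in>U. \<Sum>z\<in>U. 1 :: int)"
    proof (rule sum_strict_mono_ex1[OF assms(1)])
      show "\<forall>y\<in>U. (\<Sum>z\<in>U. of_bool (R x y \<and> R y z \<and> R x z)) \<le> (\<Sum>z\<in>U. 1 :: int)"
        by (intro ballI sum_mono) auto
      have "card U > 0" using assms by (auto simp: card_gt_0_iff)
      then show "\<exists>y\<in>U. (\<Sum>z\<in>U. of_bool (R x y \<and> R y z \<and> R x z)) < (\<Sum>z\<in>U. 1 :: int)"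
        using \<open>\<not> R x y\<close> \<open>y \<in> U\<close> by (intro bexI[of _ y]) auto
    qed
    then show "\<exists>x\<in>U. (\<Sum>y\<in>U. \<Sum>z\<in>U. of_bool (R x y \<and> R y z \<and> R x z)) < (\<Sum>y\<in>U. \<Sum>z\<in>U. 1 :: int)"
      using \<open>x \<in> U\<close> by blast
  qed
  then show False using assms(2) by (simp add: power3_eq_cube)
qed

text \<open>Convexity of the cube: with parts of size at most \<open>b\<close> and a fixed total,
  the sum of cubes is largest for full parts and one remainder, so splitting off a part
  \<open>r\<close> never helps. The remainder may equal \<open>b\<close>, which lets
  \<open>2 * b\<close> be read as one full part with remainder \<open>b\<close>.\<close>

lemma cube_sum_step:
  fixes q b s r N :: nat
  assumes "N = q * b + s" "s \<le> b" "0 < r" "r \<le> b" "r \<le> N"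
  obtains q' s' where "N - r = q' * b + s'" "s' \<le> b"
    "int r ^ 3 + (int q' * int b ^ 3 + int s' ^ 3) \<le> int q * int b ^ 3 + int s ^ 3"
    "int r ^ 3 + (int q' * int b ^ 3 + int s' ^ 3) = int q * int b ^ 3 + int s ^ 3 \<Longrightarrow> 0 < s \<Longrightarrow> r = s \<or> r = b"
proof (cases "r \<le> s")
  case True
  define d where "d = s - r"
  have s: "s = r + d" using True d_def by simp
  have eq: "int s ^ 3 = int r ^ 3 + int d ^ 3 + 3 * int r * int d * int s"
    unfolding s by (simp add: power3_eq_cube algebra_simps)
  have nn: "0 \<le> 3 * int r * int d * int s" by simp
  show thesis
  proof (rule that[of q d])
    show "N - r = q * b + d" using assms s by simp
    show "d \<le> b" using assms s by simp
    show "int r ^ 3 + (int q * int b ^ 3 + int d ^ 3) \<le> int q * int b ^ 3 + int s ^ 3"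
      using eq nn by linarith
    assume "int r ^ 3 + (int q * int b ^ 3 + int d ^ 3) = int q * int b ^ 3 + int s ^ 3" "0 < s"
    then have "3 * int r * int d * int s = 0" using eq by linarith
    then show "r = s \<or> r = b" using assms s by auto
  qed
next
  case False
  \<comment> \<open>As \<open>r\<close> exceeds the remainder but not the total, a full part exists.
    It is merged with \<open>s\<close> and re-split into \<open>r\<close> and \<open>t\<close>; the
    loss factors as \<open>3 * (b + s) * (b - r) * (r - s)\<close>.\<close>
  then obtain q' where q: "q = Suc q'" using assms by (cases q) auto
  define t where "t = b + s - r"
  have t: "int t = int b + int s - int r" using assms False unfolding t_def by simp
  have eq: "int b ^ 3 + int s ^ 3 = int r ^ 3 + int t ^ 3 + 3 * (int b + int s) * (int b - int r) * (int r - int s)"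
    unfolding t by (simp add: power3_eq_cube algebra_simps)
  have nn: "0 \<le> 3 * (int b + int s) * (int b - int r) * (int r - int s)"
    using assms False by (intro mult_nonneg_nonneg) auto
  have qq: "int q * int b ^ 3 = int q' * int b ^ 3 + int b ^ 3" unfolding q by (simp add: algebra_simps)
  show thesis
  proof (rule that[of q' t])
    show "N - r = q' * b + t" using assms False unfolding q t_def by simp
    show "t \<le> b" using assms False unfolding t_def by simp
    show "int r ^ 3 + (int q' * int b ^ 3 + int t ^ 3) \<le> int q * int b ^ 3 + int s ^ 3"
      using eq nn qq by linarith
    assume "int r ^ 3 + (int q' * int b ^ 3 + int t ^ 3) = int q * int b ^ 3 + int s ^ 3" "0 < s"
    then have "3 * (int b + int s) * (int b - int r) * (int r - int s) = 0" using eq qq by linarith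
    then show "r = s \<or> r = b" using assms False by auto
  qed
qed

context
  fixes R :: "'a \<Rightarrow> 'a \<Rightarrow> bool" and b :: nat
  assumes refl: "\<And>x. R x x" and sym: "\<And>x y. R x y \<Longrightarrow> R y x"
begin

text \<open>Duality, with the nonnegative count of mutually unrelated triples dropped.\<close>

lemma sum_tri_meeting_le:
  assumes "finite W"
  shows "(\<Sum>v\<in>W. tri R W - tri R (W - nbr R W v)) \<le> (\<Sum>v\<in>W. int (card (nbr R W v)) ^ 3)"
  unfolding triangle_duality[where R=R, OF assms sym, simplified]
  by (intro sum_mono) (simp add: tri_nonneg)

lemma nbr_props:
  assumes "finite W" "v \<in> W" "\<forall>v\<in>W. card (nbr R W v) \<le> b"
  shows "0 < card (nbr R W v)" "card (nbr R W v) \<le> card W"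
    "card (W - nbr R W v) = card W - card (nbr R W v)" "\<forall>u\<in>W - nbr R W v. card (nbr R (W - nbr R W v) u) \<le> b"
proof -
  have fin: "finite (nbr R W u)" for u using assms(1) by (simp add: nbr_def)
  show "0 < card (nbr R W v)" using assms(2) refl[of v] fin[of v] by (auto simp: card_gt_0_iff nbr_def)
  show "card (nbr R W v) \<le> card W" using assms(1) by (auto simp: nbr_def intro: card_mono)
  show "card (W - nbr R W v) = card W - card (nbr R W v)"
    by (rule card_Diff_subset[OF fin]) (auto simp: nbr_def)
  show "\<forall>u\<in>W - nbr R W v. card (nbr R (W - nbr R W v) u) \<le> b"
  proof
    fix u assume u: "u \<in> W - nbr R W v"
    have "card (nbr R (W - nbr R W v) u) \<le> card (nbr R W u)"
      by (rule card_mono[OF fin]) (auto simp: nbr_def)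
    then show "card (nbr R (W - nbr R W v) u) \<le> b" using assms(3) u by force
  qed
qed

text \<open>Chase's argument for the maximum number of triangles at bounded degree: on average over
  \<open>v\<close>, deleting the closed neighbourhood of \<open>v\<close> destroys no more triangles than a clique of
  that size contains.\<close>

lemma tri_le_cubes:
  assumes "finite W" "\<forall>v\<in>W. card (nbr R W v) \<le> b" "card W = q * b + s" "s \<le> b"
  shows "tri R W \<le> int q * int b ^ 3 + int s ^ 3"
  using assms
proof (induction "card W" arbitrary: W q s rule: less_induct)
  case less
  show ?case
  proof (cases "W = {}")
    case True
    then show ?thesis by (simp add: tri_def)
  next
    case False
    have "\<exists>v\<in>W. tri R W - tri R (W - nbr R W v) \<le> int (card (nbr R W v)) ^ 3"
    proof (rule ccontr)
      assume "\<not> ?thesis"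
      then have "(\<Sum>v\<in>W. int (card (nbr R W v)) ^ 3) < (\<Sum>v\<in>W. tri R W - tri R (W - nbr R W v))"
        using less.prems(1) False by (intro sum_strict_mono) auto
      then show False using sum_tri_meeting_le[OF less.prems(1)] by simp
    qed
    then obtain v where v: "v \<in> W" and le: "tri R W - tri R (W - nbr R W v) \<le> int (card (nbr R W v)) ^ 3" by blast
    note p = nbr_props[OF less.prems(1) v less.prems(2)]
    obtain q' s' where st: "card W - card (nbr R W v) = q' * b + s'" "s' \<le> b"
      "int (card (nbr R W v)) ^ 3 + (int q' * int b ^ 3 + int s' ^ 3) \<le> int q * int b ^ 3 + int s ^ 3"
      using cube_sum_step[OF less.prems(3,4) p(1) _ p(2)] less.prems(2) v by metis
    \<comment> \<open>By reflexivity the deleted neighbourhood contains \<open>v\<close>, so the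
      remaining set is smaller and the induction applies.\<close>
    have "tri R (W - nbr R W v) \<le> int q' * int b ^ 3 + int s' ^ 3"
      using less.prems(1) p st by (intro less.hyps) auto
    then show ?thesis using le st(3) by linarith
  qed
qed

text \<open>At equality, the upper bound for the remaining set forces every vertex to destroy at
  least the cube of its neighbourhood size. Duality says that the total is at most the sum of these
  cubes, so equality holds at each vertex, and the equality case of \<open>cube_sum_step\<close>
  fixes the sizes.\<close>

lemma tri_eq_cubesD:
  assumes W: "finite W" "\<forall>v\<in>W. card (nbr R W v) \<le> b" "card W = q * b + s" "s \<le> b" "0 < s"
    and eq: "tri R W = int q * int b ^ 3 + int s ^ 3" and v: "v \<in> W"
  shows "card (nbr R W v) = s \<or> card (nbr R W v) = b"
    and "tri R W = tri R (W - nbr R W v) + int (card (nbr R W v)) ^ 3"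
proof -
  have *: "int (card (nbr R W u)) ^ 3 \<le> tri R W - tri R (W - nbr R W u) \<and>
     (int (card (nbr R W u)) ^ 3 = tri R W - tri R (W - nbr R W u) \<longrightarrow> card (nbr R W u) = s \<or> card (nbr R W u) = b)"
    if u: "u \<in> W" for u
  proof -
    note p = nbr_props[OF W(1) u W(2)]
    obtain q' s' where st: "card W - card (nbr R W u) = q' * b + s'" "s' \<le> b"
      "int (card (nbr R W u)) ^ 3 + (int q' * int b ^ 3 + int s' ^ 3) \<le> int q * int b ^ 3 + int s ^ 3"
      "int (card (nbr R W u)) ^ 3 + (int q' * int b ^ 3 + int s' ^ 3) = int q * int b ^ 3 + int s ^ 3 \<Longrightarrow> 0 < s
        \<Longrightarrow> card (nbr R W u) = s \<or> card (nbr R W u) = b"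
      using cube_sum_step[OF W(3,4) p(1) _ p(2)] W(2) u by metis
    have "tri R (W - nbr R W u) \<le> int q' * int b ^ 3 + int s' ^ 3"
      using W p st by (intro tri_le_cubes) auto
    with st(3,4) eq W(5) show ?thesis by linarith
  qed
  have "int (card (nbr R W v)) ^ 3 = tri R W - tri R (W - nbr R W v)"
  proof (rule ccontr)
    assume "\<not> ?thesis"
    then have "\<exists>v\<in>W. int (card (nbr R W v)) ^ 3 < tri R W - tri R (W - nbr R W v)"
      using *[OF v] v by (intro bexI[of _ v]) auto
    then have "(\<Sum>v\<in>W. int (card (nbr R W v)) ^ 3) < (\<Sum>v\<in>W. tri R W - tri R (W - nbr R W v))"
      using W(1) * by (intro sum_strict_mono_ex1) auto
    then show False using sum_tri_meeting_le[OF W(1)] by simp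
  qed
  with *[OF v] show "card (nbr R W v) = s \<or> card (nbr R W v) = b"
    and "tri R W = tri R (W - nbr R W v) + int (card (nbr R W v)) ^ 3" by auto
qed

text \<open>The equality case shows that the complement of each closed neighbourhood is a clique of
  size \<open>b\<close>. Taking such a complement \<open>K\<close> and a vertex \<open>x\<close> of
  it, \<open>K\<close> is the whole neighbourhood of \<open>x\<close>, so the rest of
  \<open>W\<close> is again a complement of this kind.\<close>

lemma two_cliques:
  assumes W: "finite W" "\<forall>v\<in>W. card (nbr R W v) \<le> b" "card W = 2 * b" "0 < b"
    and eq: "tri R W = 2 * int b ^ 3"
  obtains K K' where "W = K \<union> K'" "K \<inter> K' = {}" "card K = b" "card K' = b"
    "\<forall>x\<in>K. \<forall>y\<in>K. R x y" "\<forall>x\<in>K'. \<forall>y\<in>K'. R x y"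
proof -
  have co: "card (W - nbr R W v) = b \<and> (\<forall>x\<in>W - nbr R W v. \<forall>y\<in>W - nbr R W v. R x y)" if v: "v \<in> W" for v
  proof -
    \<comment> \<open>With \<open>q = 1\<close> and \<open>s = b\<close> the two possible
      neighbourhood sizes coincide.\<close>
    have r: "card (nbr R W v) = b" "tri R W = tri R (W - nbr R W v) + int (card (nbr R W v)) ^ 3"
      using tri_eq_cubesD[OF W(1,2), of 1 b] W eq v by auto
    have c: "card (W - nbr R W v) = b" using nbr_props(3)[OF W(1) v W(2)] r W by simp
    show ?thesis using tri_full[of "W - nbr R W v" R] W(1) c r eq by auto
  qed
  have "W \<noteq> {}" using W by auto
  then obtain v where v: "v \<in> W" by blast
  define K where "K = W - nbr R W v"
  have K: "card K = b" "\<forall>x\<in>K. \<forall>y\<in>K. R x y" using co[OF v] unfolding K_def by auto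
  have "K \<noteq> {}" using K W by auto
  then obtain x where x: "x \<in> K" by blast
  have KW: "K \<subseteq> W" by (auto simp: K_def)
  then have xW: "x \<in> W" using x by blast
  have "K = nbr R W x"
  proof (rule card_seteq)
    show "finite (nbr R W x)" using W by (simp add: nbr_def)
    show "K \<subseteq> nbr R W x" using KW K(2) x unfolding nbr_def by blast
    show "card (nbr R W x) \<le> card K" using W(2) xW K by simp
  qed
  then have "card (W - K) = b" "\<forall>x\<in>W - K. \<forall>y\<in>W - K. R x y" using co[OF xW] by auto
  then show thesis using K KW by (intro that[of K "W - K"]) blast+
qed

end

subsection \<open>Graphs with few triangles\<close>

text \<open>Writing the difference as the size of a set of triples makes it monotone in
  \<open>U\<close>. For non-adjacency these are the triples spanning at least one edge.\<close>

lemma cube_minus_tri: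
  assumes "finite U"
  shows "int (card U) ^ 3 - tri R U =
    int (card {(x, y, z). x \<in> U \<and> y \<in> U \<and> z \<in> U \<and> \<not> (R x y \<and> R y z \<and> R x z)})"
proof -
  have "int (card U) ^ 3 - tri R U = (\<Sum>x\<in>U. \<Sum>y\<in>U. \<Sum>z\<in>U. 1 - of_bool (R x y \<and> R y z \<and> R x z))"
    unfolding tri_def sum_subtractf by (simp add: power3_eq_cube)
  also have "\<dots> = (\<Sum>(x, y, z)\<in>U \<times> U \<times> U. of_bool (\<not> (R x y \<and> R y z \<and> R x z)))"
    unfolding sum.cartesian_product by (intro sum.cong refl) auto
  also have "\<dots> = (\<Sum>p\<in>{p \<in> U \<times> U \<times> U. case p of (x, y, z) \<Rightarrow> \<not> (R x y \<and> R y z \<and> R x z)}. 1)"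
    unfolding sum_filter_of_bool[OF finite_cartesian_product[OF assms finite_cartesian_product[OF assms assms]]]
    by (intro sum.cong refl) auto
  also have "{p \<in> U \<times> U \<times> U. case p of (x, y, z) \<Rightarrow> \<not> (R x y \<and> R y z \<and> R x z)} =
      {(x, y, z). x \<in> U \<and> y \<in> U \<and> z \<in> U \<and> \<not> (R x y \<and> R y z \<and> R x z)}" by auto
  finally show ?thesis by simp
qed

lemma finite_triples:
  assumes "finite U"
  shows "finite {(x, y, z). x \<in> U \<and> y \<in> U \<and> z \<in> U \<and> P x y z}"
  by (rule finite_subset[of _ "U \<times> U \<times> U"]) (use assms in auto)

lemma cube_minus_tri_mono:
  assumes "finite U" "W \<subseteq> U"
  shows "int (card W) ^ 3 - tri R W \<le> int (card U) ^ 3 - tri R U"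
  unfolding cube_minus_tri[OF assms(1)] cube_minus_tri[OF finite_subset[OF assms(2,1)]] of_nat_le_iff
  by (intro card_mono finite_triples assms(1)) (use assms(2) in auto)

text \<open>Since entries may repeat, \<open>(u, x, x)\<close> is a triple gained in passing from
  \<open>W\<close> to \<open>U\<close>.\<close>

lemma cube_minus_tri_strict_mono:
  assumes "finite U" "W \<subseteq> U" "u \<in> U" "u \<notin> W" "x \<in> W" "\<not> R u x"
  shows "int (card W) ^ 3 - tri R W < int (card U) ^ 3 - tri R U"
proof -
  have "(u, x, x) \<in> {(x, y, z). x \<in> U \<and> y \<in> U \<and> z \<in> U \<and> \<not> (R x y \<and> R y z \<and> R x z)}"
    "(u, x, x) \<notin> {(x, y, z). x \<in> W \<and> y \<in> W \<and> z \<in> W \<and> \<not> (R x y \<and> R y z \<and> R x z)}"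
    using assms by auto
  moreover have "{(x, y, z). x \<in> W \<and> y \<in> W \<and> z \<in> W \<and> \<not> (R x y \<and> R y z \<and> R x z)}
     \<subseteq> {(x, y, z). x \<in> U \<and> y \<in> U \<and> z \<in> U \<and> \<not> (R x y \<and> R y z \<and> R x z)}" using assms by auto
  ultimately have "{(x, y, z). x \<in> W \<and> y \<in> W \<and> z \<in> W \<and> \<not> (R x y \<and> R y z \<and> R x z)}
     \<subset> {(x, y, z). x \<in> U \<and> y \<in> U \<and> z \<in> U \<and> \<not> (R x y \<and> R y z \<and> R x z)}" by blast
  from psubset_card_mono[OF finite_triples[OF assms(1)] this] show ?thesis
    using assms finite_subset[OF assms(2,1)] by (simp add: cube_minus_tri)
qed

lemma card_eq_sum_of_bool:
  assumes "finite V" "A \<subseteq> V"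
  shows "int (card A) = (\<Sum>w\<in>V. of_bool (w \<in> A))"
proof -
  have "A = {w \<in> V. w \<in> A}" using assms by auto
  then show ?thesis using sum_filter_of_bool[OF assms(1), of "\<lambda>_. 1" "\<lambda>w. w \<in> A"] by simp
qed

text \<open>Pointwise: an element of exactly \<open>j\<close> of the four sets contributes
  \<open>j\<close> on the left, plus 2 if \<open>j = 4\<close>, and 2 plus the number of 3-subsets
  of \<open>j\<close> sets on the right. Equality holds for \<open>j\<close> equal to 2, 3 and
  4.\<close>

lemma four_sets_card:
  assumes V: "finite V" and sub: "A \<subseteq> V" "B \<subseteq> V" "C \<subseteq> V" "D \<subseteq> V"
  shows "int (card A) + int (card B) + int (card C) + int (card D) + 2 * int (card (A \<inter> B \<inter> C \<inter> D)) \<le>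
    2 * int (card V) + int (card (A \<inter> B \<inter> C)) + int (card (A \<inter> B \<inter> D)) + int (card (A \<inter> C \<inter> D))
      + int (card (B \<inter> C \<inter> D))"
proof -
  have c: "A \<inter> B \<inter> C \<inter> D \<subseteq> V" "A \<inter> B \<inter> C \<subseteq> V" "A \<inter> B \<inter> D \<subseteq> V" "A \<inter> C \<inter> D \<subseteq> V" "B \<inter> C \<inter> D \<subseteq> V"
    using sub by auto
  show ?thesis
    unfolding card_eq_sum_of_bool[OF V order.refl] card_eq_sum_of_bool[OF V sub(1)] card_eq_sum_of_bool[OF V sub(2)]
      card_eq_sum_of_bool[OF V sub(3)] card_eq_sum_of_bool[OF V sub(4)] card_eq_sum_of_bool[OF V c(1)]
      card_eq_sum_of_bool[OF V c(2)] card_eq_sum_of_bool[OF V c(3)] card_eq_sum_of_bool[OF V c(4)]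
      card_eq_sum_of_bool[OF V c(5)] sum_distrib_left sum.distrib[symmetric]
    by (intro sum_mono) (auto simp: of_bool_def)
qed

lemma card_Un3:
  assumes "finite A" "finite B" "finite C"
  shows "int (card (A \<union> B \<union> C)) = int (card A) + int (card B) + int (card C)
    - int (card (A \<inter> B)) - int (card (A \<inter> C)) - int (card (B \<inter> C)) + int (card (A \<inter> B \<inter> C))"
proof -
  have "card (A \<union> B) + card (A \<inter> B) = card A + card B" using card_Un_Int[of A B] assms by simp
  moreover have "card (A \<union> B \<union> C) + card ((A \<union> B) \<inter> C) = card (A \<union> B) + card C"
    using card_Un_Int[of "A \<union> B" C] assms by simp
  moreover have "card ((A \<union> B) \<inter> C) + card (A \<inter> B \<inter> C) = card (A \<inter> C) + card (B \<inter> C)"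
  proof -
    have "(A \<union> B) \<inter> C = (A \<inter> C) \<union> (B \<inter> C)" "A \<inter> B \<inter> C = (A \<inter> C) \<inter> (B \<inter> C)" by auto
    then show ?thesis using card_Un_Int[of "A \<inter> C" "B \<inter> C"] assms by simp
  qed
  ultimately show ?thesis by linarith
qed

text \<open>Each vertex has at most \<open>b\<close> non-neighbours, itself included, and any three
  vertices have at least \<open>e\<close> common neighbours. The conditions on \<open>e\<close>
  encode \<open>2 * n < 3 * \<delta>\<close> and \<open>4 * \<delta> \<le> 3 * n\<close>.\<close>

locale dense_graph =
  fixes V :: "'a set" and E :: "'a \<Rightarrow> 'a \<Rightarrow> bool" and b e :: nat
  assumes fin: "finite V" and sym: "E x y \<Longrightarrow> E y x" and irrefl: "\<not> E x x"
    and order: "card V = 3 * b + e" and e_pos: "0 < e" and e_le: "e \<le> b"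
    and min_degree: "v \<in> V \<Longrightarrow> 2 * b + e \<le> card (nbr E V v)"
begin

abbreviation "N \<equiv> nbr E V"
abbreviation "nonadj \<equiv> \<lambda>x y. \<not> E x y"

lemma N_sub: "N v \<subseteq> V" by (auto simp: nbr_def)

lemma fin_N [simp]: "finite (N v)" using fin by (simp add: nbr_def)

lemma nonadj_refl: "nonadj x x" by (rule irrefl)

lemma nonadj_sym: "nonadj x y \<Longrightarrow> nonadj y x" using sym by blast

lemma in_N: "u \<in> N v \<longleftrightarrow> u \<in> V \<and> E v u" by (simp add: nbr_def)

lemma card_V_minus_N: "v \<in> V \<Longrightarrow> card (V - N v) \<le> b"
  using card_Diff_subset[OF fin_N N_sub, of v] min_degree[of v] order by simp

lemma nonadj_le: "W \<subseteq> V \<Longrightarrow> \<forall>v\<in>W. card (nbr nonadj W v) \<le> b"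
proof
  fix v assume W: "W \<subseteq> V" "v \<in> W"
  have "card (nbr nonadj W v) \<le> card (V - N v)"
    using W fin by (intro card_mono) (auto simp: nbr_def)
  then show "card (nbr nonadj W v) \<le> b" using card_V_minus_N[of v] W by auto
qed

lemma tri_nonadj_le:
  assumes "W \<subseteq> V" "card W = q * b + s" "s \<le> b"
  shows "tri nonadj W \<le> int q * int b ^ 3 + int s ^ 3"
  by (rule tri_le_cubes[where R=nonadj, OF nonadj_refl nonadj_sym finite_subset[OF assms(1) fin]
        nonadj_le[OF assms(1)] assms(2,3)])

lemma cube_diff: "int (2 * b + e) ^ 3 - (2 * int b ^ 3 + int e ^ 3) = 6 * int b * int (b + e) ^ 2"
  by (simp add: power3_eq_cube power2_eq_square algebra_simps)

text \<open>Trim \<open>N v\<close> to exactly \<open>2 * b + e\<close> vertices. There the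
  complement has at most as many ordered triples as two cliques of size \<open>b\<close> and one of
  size \<open>e\<close>, and restoring the other vertices cannot lower the number of triples that
  span an edge.\<close>

lemma local_bound:
  assumes v: "v \<in> V"
  shows "6 * int b * int (b + e) ^ 2 \<le> int (card (N v)) ^ 3 - tri nonadj (N v)"
proof -
  obtain W where W: "W \<subseteq> N v" "card W = 2 * b + e" "finite W"
    using min_degree[OF v] by (meson obtain_subset_with_card_n)
  have "tri nonadj W \<le> 2 * int b ^ 3 + int e ^ 3"
    using tri_nonadj_le[of W 2 e] W N_sub e_le by auto
  then have "6 * int b * int (b + e) ^ 2 \<le> int (card W) ^ 3 - tri nonadj W"
    using cube_diff W(2) by simp
  also have "\<dots> \<le> int (card (N v)) ^ 3 - tri nonadj (N v)"
    by (rule cube_minus_tri_mono[OF fin_N W(1)])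
  finally show ?thesis .
qed

text \<open>The excess over the triangle bound, times the order, is a sum of two nonnegative defects
  per vertex: triangles with no vertex adjacent to \<open>w\<close>, and slack in the local bound at
  \<open>w\<close>. This yields the bound, and at equality all defects vanish.\<close>

lemma duality_sum:
  "(\<Sum>w\<in>V. tri E (V - N w) + (int (card (N w)) ^ 3 - tri nonadj (N w) - 6 * int b * int (b + e) ^ 2))
    = int (card V) * (tri E V - 6 * int b * int (b + e) ^ 2)"
proof -
  have "(\<Sum>w\<in>V. tri E V) - (\<Sum>w\<in>V. tri E (V - N w)) = (\<Sum>w\<in>V. int (card (N w)) ^ 3 - tri nonadj (N w))"
    using triangle_duality[of V E, OF fin sym] by (simp add: sum_subtractf)
  then show ?thesis by (simp add: sum.distrib sum_subtractf algebra_simps)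
qed

lemma tri_ge: "6 * int b * int (b + e) ^ 2 \<le> tri E V"
proof -
  have "0 \<le> int (card V) * (tri E V - 6 * int b * int (b + e) ^ 2)"
    unfolding duality_sum[symmetric] using local_bound by (intro sum_nonneg add_nonneg_nonneg) (auto simp: tri_nonneg)
  moreover have "0 < card V" using order e_pos by simp
  ultimately show ?thesis by (simp add: zero_le_mult_iff)
qed

lemma triangle_free_if_tri_0:
  assumes "finite U" "tri E U = 0" "x \<in> U" "y \<in> U" "z \<in> U"
  shows "\<not> (E x y \<and> E y z \<and> E x z)"
proof -
  have "\<forall>x\<in>U. \<forall>y\<in>U. U \<inter> {z. E x y \<and> E y z \<and> E x z} = {}"
    using assms(1,2) unfolding tri_def by (simp add: sum_nonneg_eq_0_iff sum_nonneg)
  then show ?thesis using assms(3-5) by blast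
qed

section \<open>Structure of graphs attaining the triangle bound\<close>

context
  assumes extremal: "tri E V = 6 * int b * int (b + e) ^ 2"
begin

lemma extremal_local:
  assumes "v \<in> V"
  shows "tri E (V - N v) = 0" "int (card (N v)) ^ 3 - tri nonadj (N v) = 6 * int b * int (b + e) ^ 2"
proof -
  have all: "\<forall>w\<in>V. tri E (V - N w) + (int (card (N w)) ^ 3 - tri nonadj (N w) - 6 * int b * int (b + e) ^ 2) = 0"
  proof (subst sum_nonneg_eq_0_iff[OF fin, symmetric])
    show "0 \<le> tri E (V - N w) + (int (card (N w)) ^ 3 - tri nonadj (N w) - 6 * int b * int (b + e) ^ 2)"
      if "w \<in> V" for w
      using local_bound[OF that] tri_nonneg[of E "V - N w"] by linarith
  qed (unfold duality_sum extremal, simp)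
  show "tri E (V - N v) = 0" "int (card (N v)) ^ 3 - tri nonadj (N v) = 6 * int b * int (b + e) ^ 2"
    using bspec[OF all assms] local_bound[OF assms] tri_nonneg[of E "V - N v"] by linarith+
qed

text \<open>A surplus neighbour \<open>u\<close> of \<open>v\<close> has a neighbour in any
  \<open>2 * b + e\<close> further vertices of \<open>N v\<close>. That edge adds triples and makes
  the local bound at \<open>v\<close> strict.\<close>

lemma extremal_degree:
  assumes v: "v \<in> V"
  shows "card (N v) = 2 * b + e"
proof (rule ccontr)
  assume "\<not> ?thesis"
  then have "2 * b + e < card (N v)" using min_degree[OF v] by simp
  then obtain u where u: "u \<in> N v" by fastforce
  have "2 * b + e \<le> card (N v - {u})" using \<open>2 * b + e < card (N v)\<close> u by simp
  then obtain W where W: "W \<subseteq> N v - {u}" "card W = 2 * b + e" "finite W"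
    by (meson obtain_subset_with_card_n)
  have "\<not> W \<subseteq> V - N u"
  proof
    assume "W \<subseteq> V - N u"
    then have "card W \<le> b" using card_mono[of "V - N u" W] card_V_minus_N[of u] u fin by (force simp: in_N)
    then show False using W e_pos by simp
  qed
  then obtain x where x: "x \<in> W" "E u x" using W N_sub by (auto simp: in_N)
  have "tri nonadj W \<le> 2 * int b ^ 3 + int e ^ 3"
    using tri_nonadj_le[of W 2 e] W N_sub e_le by auto
  then have "6 * int b * int (b + e) ^ 2 \<le> int (card W) ^ 3 - tri nonadj W"
    using cube_diff W(2) by simp
  also have "\<dots> < int (card (N v)) ^ 3 - tri nonadj (N v)"
    using W u x by (intro cube_minus_tri_strict_mono[of _ _ u x]) auto
  finally show False using extremal_local(2)[OF v] by simp
qed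

lemma extremal_tri_nonadj:
  assumes "v \<in> V"
  shows "tri nonadj (N v) = 2 * int b ^ 3 + int e ^ 3"
  using extremal_local(2)[OF assms] cube_diff unfolding extremal_degree[OF assms] by linarith

lemma nbr_nonadj_N: "N v - nbr nonadj (N v) u = N v \<inter> N u"
  by (auto simp: nbr_def)

text \<open>The equality case \<open>tri_eq_cubesD\<close> is applied to non-adjacency on
  \<open>N v\<close>, with \<open>q = 2\<close> and \<open>s = e\<close>: there \<open>u\<close> has
  \<open>e\<close> or \<open>b\<close> non-neighbours. When \<open>e\<close> are removed, exactly
  \<open>2 * b ^ 3\<close> ordered triples remain, as \<open>two_cliques\<close> requires.\<close>

lemma extremal_codegree:
  assumes v: "v \<in> V" and u: "u \<in> N v"
  shows "card (N v \<inter> N u) = 2 * b \<or> card (N v \<inter> N u) = b + e"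
    and "card (N v \<inter> N u) = 2 * b \<Longrightarrow> tri nonadj (N v \<inter> N u) = 2 * int b ^ 3"
proof -
  have le: "\<forall>w\<in>N v. card (nbr nonadj (N v) w) \<le> b" by (rule nonadj_le[OF N_sub])
  have sz: "card (N v) = 2 * b + e" by (rule extremal_degree[OF v])
  have D: "card (nbr nonadj (N v) u) = e \<or> card (nbr nonadj (N v) u) = b"
    "tri nonadj (N v) = tri nonadj (N v - nbr nonadj (N v) u) + int (card (nbr nonadj (N v) u)) ^ 3"
    using tri_eq_cubesD[where R=nonadj, OF nonadj_refl nonadj_sym fin_N le sz e_le e_pos _ u]
      extremal_tri_nonadj[OF v] by simp_all
  have "card (N v - nbr nonadj (N v) u) = card (N v) - card (nbr nonadj (N v) u)"
    by (rule nbr_props(3)[where R=nonadj, OF nonadj_refl nonadj_sym fin_N u le])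
  then have c: "card (N v \<inter> N u) = 2 * b + e - card (nbr nonadj (N v) u)" using sz nbr_nonadj_N by simp
  then show "card (N v \<inter> N u) = 2 * b \<or> card (N v \<inter> N u) = b + e" using D by auto
  assume "card (N v \<inter> N u) = 2 * b"
  then have "card (nbr nonadj (N v) u) = e" using c D(1) e_pos by auto
  then show "tri nonadj (N v \<inter> N u) = 2 * int b ^ 3"
    using D(2) extremal_tri_nonadj[OF v] nbr_nonadj_N by simp
qed

text \<open>Suppose all codegrees are \<open>b + e\<close>. Every vertex has a neighbour in every
  triangle, so inclusion-exclusion gives each triangle exactly \<open>e\<close> common neighbours.
  As \<open>e\<close> is positive, a 4-clique exists, and the four-set inequality around it forces
  \<open>b = e\<close>, where \<open>b + e\<close> is \<open>2 * b\<close> after all.\<close>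

lemma extremal_heavy_edge:
  shows "\<exists>v\<in>V. \<exists>u\<in>N v. card (N v \<inter> N u) = 2 * b"
proof (rule ccontr)
  assume "\<not> ?thesis"
  then have no: "card (N v \<inter> N u) \<noteq> 2 * b" if "v \<in> V" "u \<in> N v" for v u using that by blast
  then have cd: "card (N v \<inter> N u) = b + e" if "v \<in> V" "u \<in> N v" for v u
    using extremal_codegree(1) that by blast
  have trip: "card (N x \<inter> N y \<inter> N z) = e" if T: "x \<in> V" "y \<in> N x" "z \<in> N x \<inter> N y" for x y z
  proof -
    have yz: "y \<in> V" "z \<in> V" "z \<in> N x" "z \<in> N y" using T by (auto simp: in_N)
    have "N x \<union> N y \<union> N z = V"
    proof -
      have "w \<in> N x \<union> N y \<union> N z" if w: "w \<in> V" for w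
      proof (rule ccontr)
        assume "w \<notin> N x \<union> N y \<union> N z"
        then have "x \<in> V - N w" "y \<in> V - N w" "z \<in> V - N w" using T yz w sym by (auto simp: in_N)
        then show False using triangle_free_if_tri_0[of "V - N w" x y z] fin extremal_local(1)[OF w] T yz
          by (auto simp: in_N)
      qed
      then show ?thesis using N_sub by blast
    qed
    then have "int (card V) = 3 * int (2 * b + e) - 3 * int (b + e) + int (card (N x \<inter> N y \<inter> N z))"
      using card_Un3[of "N x" "N y" "N z"] extremal_degree T(1) yz cd[OF T(1,2)] cd[OF T(1) yz(3)] cd[OF yz(1,4)] by simp
    then show ?thesis using order by simp
  qed
  have nonempty: "\<exists>x. x \<in> A" if "0 < card A" for A :: "'a set" using that by (cases "A = {}") auto
  obtain x where x: "x \<in> V" using nonempty[of V] order e_pos by auto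
  obtain y where y: "y \<in> N x" using nonempty[of "N x"] extremal_degree[OF x] e_pos by auto
  obtain z where z: "z \<in> N x \<inter> N y" using nonempty[of "N x \<inter> N y"] cd[OF x y] e_pos by auto
  obtain w where w: "w \<in> N x \<inter> N y \<inter> N z" using nonempty[of "N x \<inter> N y \<inter> N z"] trip[OF x y z] e_pos by auto
  have in_V: "y \<in> V" "z \<in> V" "w \<in> V" using y z w by (auto simp: in_N)
  have t: "card (N x \<inter> N y \<inter> N z) = e" "card (N x \<inter> N y \<inter> N w) = e" "card (N x \<inter> N z \<inter> N w) = e"
    "card (N y \<inter> N z \<inter> N w) = e"
    using x y z w in_V by (auto intro!: trip)
  have "b \<noteq> e"
    using cd[OF x y] no[OF x y] by auto
  \<comment> \<open>With \<open>D\<close> common neighbours of all four vertices, the inequality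
    reads \<open>4 * (2 * b + e) + 2 * D \<le> 2 * (3 * b + e) + 4 * e\<close>, that is,
    \<open>b + D \<le> e\<close>.\<close>
  then show False
    using four_sets_card[OF fin N_sub N_sub N_sub N_sub, of x y z w] t e_le order
      extremal_degree[OF x] extremal_degree[OF in_V(1)] extremal_degree[OF in_V(2)] extremal_degree[OF in_V(3)]
    by simp
qed

text \<open>The common neighbourhood of a heavy edge splits into two independent sets of size
  \<open>b\<close>. Such a set fills the whole non-neighbourhood of each of its vertices, so it is
  completely joined to the rest.\<close>

lemma extremal_partition:
  obtains A B where "A \<subseteq> V" "B \<subseteq> V" "A \<inter> B = {}" "card A = b" "card B = b"
    "\<And>x y. x \<in> A \<Longrightarrow> y \<in> V \<Longrightarrow> E x y \<longleftrightarrow> y \<notin> A"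
    "\<And>x y. x \<in> B \<Longrightarrow> y \<in> V \<Longrightarrow> E x y \<longleftrightarrow> y \<notin> B"
proof -
  obtain v u where vu: "v \<in> V" "u \<in> N v" "card (N v \<inter> N u) = 2 * b" using extremal_heavy_edge by blast
  have t: "tri nonadj (N v \<inter> N u) = 2 * int b ^ 3" by (rule extremal_codegree(2)[OF vu])
  have sub: "N v \<inter> N u \<subseteq> V" using N_sub by blast
  obtain K K' where K: "N v \<inter> N u = K \<union> K'" "K \<inter> K' = {}" "card K = b" "card K' = b"
    "\<forall>x\<in>K. \<forall>y\<in>K. nonadj x y" "\<forall>x\<in>K'. \<forall>y\<in>K'. nonadj x y"
    using two_cliques[where R=nonadj, OF nonadj_refl nonadj_sym finite_subset[OF sub fin] nonadj_le[OF sub] vu(3) _ t]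
      e_pos e_le by auto
  have adj: "E x y \<longleftrightarrow> y \<notin> A" if A: "A \<subseteq> V" "card A = b" "\<forall>x\<in>A. \<forall>y\<in>A. nonadj x y" "x \<in> A" "y \<in> V" for A x y
  proof -
    have "A = V - N x"
    proof (rule card_seteq)
      show "A \<subseteq> V - N x" using A by (auto simp: in_N)
      show "card (V - N x) \<le> card A" using card_V_minus_N[of x] A by auto
    qed (use fin in auto)
    then have "y \<notin> A \<longleftrightarrow> y \<in> N x" using A(5) by blast
    then show ?thesis using A(5) by (simp add: in_N)
  qed
  have "K \<subseteq> V" "K' \<subseteq> V" using K(1) sub by auto
  then show thesis using K adj[of K] adj[of K'] by (intro that[of K K']) blast+
qed

end

end

subsection \<open>Triangles and 4-cliques\<close>

definition quad :: "('a \<Rightarrow> 'a \<Rightarrow> bool) \<Rightarrow> 'a set \<Rightarrow> int" where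
  "quad R U = (\<Sum>w\<in>U. \<Sum>x\<in>U. \<Sum>y\<in>U. \<Sum>z\<in>U.
     of_bool (R w x \<and> R w y \<and> R w z \<and> R x y \<and> R y z \<and> R x z))"

context dense_graph
begin

definition codeg3 :: "'a \<Rightarrow> 'a \<Rightarrow> 'a \<Rightarrow> int" where
  "codeg3 x y z = int (card (N x \<inter> N y \<inter> N z))"

lemma codeg3_ge:
  assumes "x \<in> V" "y \<in> V" "z \<in> V"
  shows "int e \<le> codeg3 x y z"
proof -
  have pair: "card A + card B \<le> card (A \<inter> B) + card V" if "A \<subseteq> V" "B \<subseteq> V" for A B
    using card_Un_Int[of A B] card_mono[of V "A \<union> B"] finite_subset[OF _ fin] that fin by auto
  have "N x \<inter> N y \<subseteq> V" using N_sub by blast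
  from pair[OF N_sub N_sub, of x y] pair[OF this N_sub, of z]
  show ?thesis
    using min_degree[OF assms(1)] min_degree[OF assms(2)] min_degree[OF assms(3)] order
    unfolding codeg3_def by simp
qed

lemma codeg3_sum:
  assumes "z \<in> V"
  shows "codeg3 x y z = (\<Sum>w\<in>V. of_bool (E x w \<and> E y w \<and> E z w))"
  unfolding codeg3_def
  by (subst card_eq_sum_of_bool[OF fin]) (auto simp: nbr_def intro!: sum.cong)

text \<open>Let \<open>D\<close> be the number of common neighbours of the 4-clique. The four
  codegrees sum to at least \<open>2 * (b + e) + 2 * D\<close>, and each is at most
  \<open>b + D\<close>. If at most two exceed \<open>b\<close>, capping costs at most
  \<open>2 * D\<close>; if three do, the capped sum is at least \<open>3 * b + e\<close>, which
  suffices since \<open>e \<le> b\<close>.\<close>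

lemma capped_codegrees:
  assumes V: "w \<in> V" "x \<in> V" "y \<in> V" "z \<in> V" and K: "E w x" "E w y" "E w z" "E x y" "E y z" "E x z"
  shows "2 * int (b + e) \<le> min (codeg3 x y z) b + min (codeg3 w y z) b + min (codeg3 w x z) b + min (codeg3 w x y) b"
proof -
  define D where "D = int (card (N w \<inter> N x \<inter> N y \<inter> N z))"
  have s: "2 * int (b + e) + 2 * D \<le> codeg3 x y z + codeg3 w y z + codeg3 w x z + codeg3 w x y"
    using four_sets_card[OF fin N_sub N_sub N_sub N_sub, of w x y z] order
      min_degree[OF V(1)] min_degree[OF V(2)] min_degree[OF V(3)] min_degree[OF V(4)]
    unfolding codeg3_def D_def by simp
  \<comment> \<open>Common neighbours of a triangle that are not adjacent to the fourth vertex lie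
    among its at most \<open>b\<close> non-neighbours.\<close>
  have heavy: "int (card A) - int b \<le> D" if "A \<subseteq> V" "u \<in> V" "A \<inter> N u = N w \<inter> N x \<inter> N y \<inter> N z" for A u
  proof -
    have "card A = card (A \<inter> N u) + card (A - N u)"
      using card_Int_Diff[of A "N u"] finite_subset[OF that(1) fin] by simp
    moreover have "card (A - N u) \<le> card (V - N u)" using that fin by (intro card_mono) auto
    ultimately show ?thesis using card_V_minus_N[OF that(2)] that(3) unfolding D_def by simp
  qed
  have sub: "N p \<inter> N q \<inter> N r \<subseteq> V" for p q r using N_sub by blast
  have "codeg3 x y z - b \<le> D" unfolding codeg3_def by (rule heavy[OF sub V(1)]) auto
  moreover have "codeg3 w y z - b \<le> D" unfolding codeg3_def by (rule heavy[OF sub V(2)]) auto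
  moreover have "codeg3 w x z - b \<le> D" unfolding codeg3_def by (rule heavy[OF sub V(3)]) auto
  moreover have "codeg3 w x y - b \<le> D" unfolding codeg3_def by (rule heavy[OF sub V(4)]) auto
  moreover have "0 \<le> D" by (simp add: D_def)
  moreover note codeg3_ge[OF V(2,3,4)] codeg3_ge[OF V(1,3,4)] codeg3_ge[OF V(1,2,4)] codeg3_ge[OF V(1,2,3)]
  ultimately show ?thesis using s e_le unfolding min_def by (simp split: if_splits)
qed

lemma quad_weighted:
  "(\<Sum>w\<in>V. \<Sum>x\<in>V. \<Sum>y\<in>V. \<Sum>z\<in>V.
      of_bool (E w x \<and> E w y \<and> E w z \<and> E x y \<and> E y z \<and> E x z) * c x y z)
    = (\<Sum>x\<in>V. \<Sum>y\<in>V. \<Sum>z\<in>V. of_bool (E x y \<and> E y z \<and> E x z) * (codeg3 x y z * c x y z))"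
proof -
  have "(\<Sum>w\<in>V. \<Sum>x\<in>V. \<Sum>y\<in>V. \<Sum>z\<in>V.
      of_bool (E w x \<and> E w y \<and> E w z \<and> E x y \<and> E y z \<and> E x z) * c x y z)
     = (\<Sum>x\<in>V. \<Sum>y\<in>V. \<Sum>z\<in>V. \<Sum>w\<in>V.
      of_bool (E w x \<and> E w y \<and> E w z \<and> E x y \<and> E y z \<and> E x z) * c x y z)"
    by (subst sum4_swap12, subst sum4_swap23, subst sum4_swap34) (rule refl)
  also have "\<dots> = (\<Sum>x\<in>V. \<Sum>y\<in>V. \<Sum>z\<in>V. of_bool (E x y \<and> E y z \<and> E x z) * (codeg3 x y z * c x y z))"
  proof (intro sum.cong refl)
    fix x y z assume "x \<in> V" "y \<in> V" "z \<in> V"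
    then show "(\<Sum>w\<in>V. of_bool (E w x \<and> E w y \<and> E w z \<and> E x y \<and> E y z \<and> E x z) * c x y z) =
        of_bool (E x y \<and> E y z \<and> E x z) * (codeg3 x y z * c x y z)"
      unfolding codeg3_sum[OF \<open>z \<in> V\<close>] sum_distrib_left sum_distrib_right
      by (intro sum.cong refl) (use sym in auto)
  qed
  finally show ?thesis .
qed

text \<open>Summing \<open>capped_codegrees\<close> over ordered 4-cliques bounds
  \<open>2 * (b + e) * quad E V\<close> by \<open>4 * X\<close>, where \<open>X\<close> weights
  triangles by codegree times capped codegree. A linear upper bound for this weight returns
  \<open>quad E V\<close> and \<open>tri E V\<close>.\<close>

lemma quad_ge: "2 * int b * int e * tri E V \<le> int (b + e) * quad E V"
proof -
  define c where "c x y z = min (codeg3 x y z) (int b)" for x y z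
  define k where "k w x y z = (of_bool (E w x \<and> E w y \<and> E w z \<and> E x y \<and> E y z \<and> E x z) :: int)" for w x y z
  define t where "t x y z = (of_bool (E x y \<and> E y z \<and> E x z) :: int)" for x y z
  define S where "S f = (\<Sum>w\<in>V. \<Sum>x\<in>V. \<Sum>y\<in>V. \<Sum>z\<in>V. f w x y z)" for f :: "'a \<Rightarrow> 'a \<Rightarrow> 'a \<Rightarrow> 'a \<Rightarrow> int"
  have s12: "S f = S (\<lambda>w x y z. f x w y z)" for f unfolding S_def by (rule sum4_swap12)
  have s23: "S f = S (\<lambda>w x y z. f w y x z)" for f unfolding S_def by (rule sum4_swap23)
  have s34: "S f = S (\<lambda>w x y z. f w x z y)" for f unfolding S_def by (rule sum4_swap34)
  have ks: "k x w y z = k w x y z" "k w y x z = k w x y z" "k w x z y = k w x y z" for w x y z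
    unfolding k_def using sym by (auto intro!: arg_cong[where f=of_bool])
  have Q: "quad E V = S k" unfolding quad_def S_def k_def ..
  \<comment> \<open>By symmetry each of the four triangles of a 4-clique contributes the same
    total.\<close>
  define X where "X = S (\<lambda>w x y z. k w x y z * c x y z)"
  have X2: "S (\<lambda>w x y z. k w x y z * c w y z) = X"
    unfolding X_def by (subst s12) (simp add: ks)
  have X3: "S (\<lambda>w x y z. k w x y z * c w x z) = X"
    unfolding X2[symmetric] by (subst s23) (simp add: ks)
  have X4: "S (\<lambda>w x y z. k w x y z * c w x y) = X"
    unfolding X3[symmetric] by (subst s34) (simp add: ks)
  have "2 * int (b + e) * quad E V = S (\<lambda>w x y z. k w x y z * (2 * int (b + e)))"
    unfolding Q S_def sum_distrib_left by (simp add: mult_ac)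
  also have "\<dots> \<le> S (\<lambda>w x y z. k w x y z * (c x y z + c w y z + c w x z + c w x y))"
    unfolding S_def
  proof (intro sum_mono)
    fix w x y z assume "w \<in> V" "x \<in> V" "y \<in> V" "z \<in> V"
    then show "k w x y z * (2 * int (b + e)) \<le> k w x y z * (c x y z + c w y z + c w x z + c w x y)"
      using capped_codegrees[of w x y z] unfolding k_def c_def by (cases "E w x \<and> E w y \<and> E w z \<and> E x y \<and> E y z \<and> E x z") auto
  qed
  also have "\<dots> = S (\<lambda>w x y z. k w x y z * c x y z) + S (\<lambda>w x y z. k w x y z * c w y z)
      + S (\<lambda>w x y z. k w x y z * c w x z) + S (\<lambda>w x y z. k w x y z * c w x y)"
    unfolding S_def by (simp add: sum.distrib distrib_left)
  also have "\<dots> = 4 * X" unfolding X2 X3 X4 unfolding X_def by simp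
  also have "X = (\<Sum>x\<in>V. \<Sum>y\<in>V. \<Sum>z\<in>V. t x y z * (codeg3 x y z * c x y z))"
    unfolding X_def S_def k_def t_def by (rule quad_weighted)
  \<comment> \<open>The linear function is the secant of the square through \<open>e\<close> and
    \<open>b\<close>, valid between them; beyond \<open>b\<close> the capped weight grows with slope
    \<open>b\<close>, less than \<open>b + e\<close>.\<close>
  also have "\<dots> \<le> (\<Sum>x\<in>V. \<Sum>y\<in>V. \<Sum>z\<in>V. t x y z * (codeg3 x y z * int (b + e) - int b * int e))"
  proof (intro sum_mono mult_left_mono)
    fix x y z assume "x \<in> V" "y \<in> V" "z \<in> V"
    then have "int e \<le> codeg3 x y z" by (rule codeg3_ge)
    moreover have "0 \<le> (codeg3 x y z - int e) * (int b - codeg3 x y z)" if "codeg3 x y z \<le> int b"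
      using that calculation by simp
    moreover have "0 \<le> (codeg3 x y z - int b) * int e" if "\<not> codeg3 x y z \<le> int b"
      using that by simp
    ultimately show "codeg3 x y z * c x y z \<le> codeg3 x y z * int (b + e) - int b * int e"
      unfolding c_def min_def by (auto simp: algebra_simps)
  qed (simp add: t_def)
  also have "\<dots> = int (b + e) * (\<Sum>x\<in>V. \<Sum>y\<in>V. \<Sum>z\<in>V. t x y z * (codeg3 x y z * 1)) - int b * int e * tri E V"
    unfolding tri_def t_def by (simp add: sum_subtractf sum_distrib_left right_diff_distrib mult_ac)
  also have "(\<Sum>x\<in>V. \<Sum>y\<in>V. \<Sum>z\<in>V. t x y z * (codeg3 x y z * 1)) = quad E V"
    unfolding t_def quad_def quad_weighted[symmetric] by simp
  finally show ?thesis by (simp add: algebra_simps)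
qed

end

subsection \<open>Counting cliques\<close>

definition cliques :: "nat \<Rightarrow> 'a set \<Rightarrow> ('a \<Rightarrow> 'a \<Rightarrow> bool) \<Rightarrow> 'a set set" where
  "cliques r V E = {S. S \<subseteq> V \<and> card S = r \<and> (\<forall>x\<in>S. \<forall>y\<in>S. x \<noteq> y \<longrightarrow> E x y)}"

lemma clique_count_cliques: "clique_count r V E = card (cliques r V E)"
  by (simp add: clique_count_def cliques_def)

lemma finite_cliques: "finite V \<Longrightarrow> finite (cliques r V E)"
  by (rule finite_subset[of _ "Pow V"]) (auto simp: cliques_def)

text \<open>A clique of size \<open>Suc r\<close> is counted once at each of its vertices, as that
  vertex together with an \<open>r\<close>-clique in its neighbourhood.\<close>

lemma clique_count_Suc:
  assumes V: "finite V" and sym: "\<And>x y. E x y \<Longrightarrow> E y x" and irrefl: "\<And>x. \<not> E x x"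
  shows "Suc r * clique_count (Suc r) V E = (\<Sum>v\<in>V. clique_count r (nbr E V v) E)"
proof -
  let ?C = "cliques (Suc r) V E"
  have "Suc r * card ?C = (\<Sum>v\<in>V. card {S \<in> ?C. v \<in> S})"
  proof (rule sum_multicount[symmetric, OF V finite_cliques[OF V]], intro ballI)
    fix S assume S: "S \<in> ?C"
    then have "{v \<in> V. v \<in> S} = S" by (auto simp: cliques_def)
    then show "card {v \<in> V. v \<in> S} = Suc r" using S by (simp add: cliques_def)
  qed
  also have "\<dots> = (\<Sum>v\<in>V. clique_count r (nbr E V v) E)"
  proof (intro sum.cong refl)
    fix v assume v: "v \<in> V"
    have "bij_betw (insert v) (cliques r (nbr E V v) E) {S \<in> ?C. v \<in> S}"
    proof (rule bij_betw_byWitness[where f' = "\<lambda>S. S - {v}"])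
      show "\<forall>S\<in>cliques r (nbr E V v) E. insert v S - {v} = S"
        using irrefl by (auto simp: cliques_def nbr_def)
      show "\<forall>S\<in>{S \<in> ?C. v \<in> S}. insert v (S - {v}) = S" by auto
      show "insert v ` cliques r (nbr E V v) E \<subseteq> {S \<in> ?C. v \<in> S}"
      proof
        fix T assume "T \<in> insert v ` cliques r (nbr E V v) E"
        then obtain S where S: "T = insert v S" "S \<subseteq> nbr E V v" "card S = r" "\<forall>x\<in>S. \<forall>y\<in>S. x \<noteq> y \<longrightarrow> E x y"
          by (auto simp: cliques_def)
        have "finite S" using S(2) V finite_subset by (fastforce simp: nbr_def)
        moreover have "v \<notin> S" using S(2) irrefl by (auto simp: nbr_def)
        ultimately show "T \<in> {S \<in> ?C. v \<in> S}" using S v sym unfolding cliques_def nbr_def by auto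
      qed
      show "(\<lambda>S. S - {v}) ` {S \<in> ?C. v \<in> S} \<subseteq> cliques r (nbr E V v) E"
        using finite_subset[OF _ V] unfolding cliques_def nbr_def by auto
    qed
    then show "card {S \<in> ?C. v \<in> S} = clique_count r (nbr E V v) E"
      unfolding clique_count_cliques by (simp add: bij_betw_same_card)
  qed
  finally show ?thesis unfolding clique_count_cliques .
qed

lemma clique_count_0: "finite V \<Longrightarrow> clique_count 0 V E = 1"
proof -
  assume "finite V"
  then have "cliques 0 V E = {{}}" by (auto simp: cliques_def finite_subset)
  then show ?thesis by (simp add: clique_count_cliques)
qed

lemma clique_count_cong:
  assumes "\<And>x y. x \<in> V \<Longrightarrow> y \<in> V \<Longrightarrow> E x y \<longleftrightarrow> F x y"
  shows "clique_count r V E = clique_count r V F"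
proof -
  have "cliques r V E = cliques r V F"
    unfolding cliques_def using assms by (intro Collect_cong) (meson subsetD)
  then show ?thesis by (simp add: clique_count_cliques)
qed

lemma clique_count_image:
  assumes "inj_on f U"
  shows "clique_count r (f ` U) E = clique_count r U (\<lambda>x y. E (f x) (f y))"
proof -
  have inj: "inj_on f S" if "S \<subseteq> U" for S using inj_on_subset[OF assms that] .
  have "cliques r (f ` U) E = image f ` cliques r U (\<lambda>x y. E (f x) (f y))"
  proof (intro equalityI subsetI)
    fix T assume "T \<in> cliques r (f ` U) E"
    then have T: "T \<subseteq> f ` U" "card T = r" "\<forall>x\<in>T. \<forall>y\<in>T. x \<noteq> y \<longrightarrow> E x y" by (auto simp: cliques_def)
    obtain S where S: "S \<subseteq> U" "T = f ` S" using T(1) by (meson subset_imageE)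
    have "E (f x) (f y)" if "x \<in> S" "y \<in> S" "x \<noteq> y" for x y
      using that T(3) S(2) inj_onD[OF inj[OF S(1)], of x y] by blast
    then have "S \<in> cliques r U (\<lambda>x y. E (f x) (f y))"
      using T(2) S card_image[OF inj[OF S(1)]] by (simp add: cliques_def)
    then show "T \<in> image f ` cliques r U (\<lambda>x y. E (f x) (f y))" using S by blast
  next
    fix T assume "T \<in> image f ` cliques r U (\<lambda>x y. E (f x) (f y))"
    then obtain S where S: "T = f ` S" "S \<subseteq> U" "card S = r" "\<forall>x\<in>S. \<forall>y\<in>S. x \<noteq> y \<longrightarrow> E (f x) (f y)"
      by (auto simp: cliques_def)
    then show "T \<in> cliques r (f ` U) E"
      using card_image[OF inj[OF S(2)]] by (auto simp: cliques_def)
  qed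
  moreover have "inj_on (image f) (cliques r U (\<lambda>x y. E (f x) (f y)))"
    by (rule inj_on_subset[OF inj_on_image_Pow[OF assms]]) (auto simp: cliques_def)
  ultimately show ?thesis by (simp add: clique_count_cliques card_image)
qed

lemma clique_count_eq_0_Suc:
  assumes "finite V" "clique_count r V E = 0"
  shows "clique_count (Suc r) V E = 0"
proof -
  have "cliques r V E = {}" using assms finite_cliques[OF assms(1)] by (simp add: clique_count_cliques)
  moreover have "\<exists>T. T \<in> cliques r V E" if S: "S \<in> cliques (Suc r) V E" for S
  proof -
    obtain T where "T \<subseteq> S" "card T = r"
      using S obtain_subset_with_card_n[of r S] by (auto simp: cliques_def)
    then show ?thesis using S by (intro exI[of _ T]) (auto simp: cliques_def)
  qed
  ultimately have "cliques (Suc r) V E = {}" by blast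
  then show ?thesis by (simp add: clique_count_cliques)
qed

context
  fixes E :: "'a \<Rightarrow> 'a \<Rightarrow> bool"
  assumes sym: "\<And>x y. E x y \<Longrightarrow> E y x" and irrefl: "\<And>x. \<not> E x x"
begin

lemma clique_count_1: "finite V \<Longrightarrow> clique_count 1 V E = card V"
  using clique_count_Suc[of V E 0, OF _ sym irrefl] by (simp add: clique_count_0 nbr_def)

lemma clique_count_2: "finite V \<Longrightarrow> 2 * clique_count 2 V E = (\<Sum>v\<in>V. card (nbr E V v))"
  using clique_count_Suc[of V E 1, OF _ sym irrefl]
  by (simp add: clique_count_1[unfolded One_nat_def] nbr_def numeral_2_eq_2)

lemma clique_count_3:
  assumes "finite V"
  shows "6 * int (clique_count 3 V E) = tri E V"
proof -
  have "3 * clique_count 3 V E = (\<Sum>v\<in>V. clique_count 2 (nbr E V v) E)"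
    using clique_count_Suc[of V E 2, OF assms sym irrefl] by (simp add: numeral_3_eq_3 numeral_2_eq_2)
  then have "6 * clique_count 3 V E = (\<Sum>v\<in>V. 2 * clique_count 2 (nbr E V v) E)"
    by (simp add: sum_distrib_left[symmetric])
  also have "\<dots> = (\<Sum>v\<in>V. \<Sum>u\<in>nbr E V v. card (nbr E (nbr E V v) u))"
    using assms by (intro sum.cong refl clique_count_2) (simp add: nbr_def)
  finally have "6 * int (clique_count 3 V E) = (\<Sum>v\<in>V. \<Sum>u\<in>nbr E V v. int (card (nbr E (nbr E V v) u)))"
    by (metis (no_types, lifting) of_nat_mult of_nat_numeral of_nat_sum sum.cong)
  also have "\<dots> = tri E V"
    unfolding tri_def
  proof (rule sum.cong[OF refl])
    fix x assume "x \<in> V"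
    have "int (card (nbr E (nbr E V x) y)) = (\<Sum>z\<in>V. of_bool (E y z \<and> E x z))" for y
    proof -
      have "nbr E (nbr E V x) y \<subseteq> V" by (auto simp: nbr_def)
      then show ?thesis
        unfolding card_eq_sum_of_bool[OF assms \<open>nbr E (nbr E V x) y \<subseteq> V\<close>]
        by (intro sum.cong refl) (auto simp: nbr_def)
    qed
    then show "(\<Sum>u\<in>nbr E V x. int (card (nbr E (nbr E V x) u))) =
        (\<Sum>y\<in>V. \<Sum>z\<in>V. of_bool (E x y \<and> E y z \<and> E x z))"
      by (simp only: nbr_def[of E V x] sum_filter_of_bool[OF assms] sum_distrib_left of_bool_conj mult.assoc)
  qed
  finally show ?thesis .
qed

lemma clique_count_4:
  assumes "finite V"
  shows "24 * int (clique_count 4 V E) = quad E V"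
proof -
  have "4 * clique_count 4 V E = (\<Sum>v\<in>V. clique_count 3 (nbr E V v) E)"
    using clique_count_Suc[of V E 3, OF assms sym irrefl] by (simp add: eval_nat_numeral)
  then have "4 * int (clique_count 4 V E) = (\<Sum>v\<in>V. int (clique_count 3 (nbr E V v) E))"
    by (metis of_nat_mult of_nat_numeral of_nat_sum)
  then have "24 * int (clique_count 4 V E) = (\<Sum>v\<in>V. 6 * int (clique_count 3 (nbr E V v) E))"
    by (simp add: sum_distrib_left[symmetric])
  also have "\<dots> = (\<Sum>v\<in>V. tri E (nbr E V v))"
    using assms by (intro sum.cong refl clique_count_3) (simp add: nbr_def)
  also have "\<dots> = quad E V"
    unfolding nbr_def tri_filter[OF assms] quad_def by (intro sum.cong refl) auto
  finally show ?thesis .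
qed

text \<open>A clique has at most one vertex in the independent set \<open>A\<close>, and every
  vertex of \<open>A\<close> extends every clique of \<open>U\<close>.\<close>

lemma clique_count_join:
  assumes fin: "finite A" "finite U" and disj: "A \<inter> U = {}"
    and indep: "\<And>x y. x \<in> A \<Longrightarrow> y \<in> A \<Longrightarrow> \<not> E x y" and join: "\<And>x y. x \<in> A \<Longrightarrow> y \<in> U \<Longrightarrow> E x y"
  shows "clique_count (Suc r) (A \<union> U) E = clique_count (Suc r) U E + card A * clique_count r U E"
proof -
  let ?f = "\<lambda>(a, S). insert a S"
  have split: "cliques (Suc r) (A \<union> U) E = cliques (Suc r) U E \<union> ?f ` (A \<times> cliques r U E)"
  proof (intro equalityI subsetI)
    fix S assume "S \<in> cliques (Suc r) (A \<union> U) E"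
    then have S: "S \<subseteq> A \<union> U" "card S = Suc r" "\<forall>x\<in>S. \<forall>y\<in>S. x \<noteq> y \<longrightarrow> E x y" by (auto simp: cliques_def)
    show "S \<in> cliques (Suc r) U E \<union> ?f ` (A \<times> cliques r U E)"
    proof (cases "S \<inter> A = {}")
      case True
      then show ?thesis using S by (auto simp: cliques_def)
    next
      case False
      then obtain a where a: "a \<in> S" "a \<in> A" by blast
      have "S - {a} \<subseteq> U" using S(1,3) a indep by blast
      moreover have "card (S - {a}) = r" using S(2) a by simp
      ultimately have "S - {a} \<in> cliques r U E" using S(3) by (auto simp: cliques_def)
      then have "(a, S - {a}) \<in> A \<times> cliques r U E" using a by blast
      moreover have "S = ?f (a, S - {a})" using a by auto
      ultimately show ?thesis by blast
    qed
  next
    fix S assume "S \<in> cliques (Suc r) U E \<union> ?f ` (A \<times> cliques r U E)"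
    then show "S \<in> cliques (Suc r) (A \<union> U) E"
    proof
      assume "S \<in> cliques (Suc r) U E"
      then show ?thesis by (auto simp: cliques_def)
    next
      assume "S \<in> ?f ` (A \<times> cliques r U E)"
      then obtain a T where T: "S = insert a T" "a \<in> A" "T \<subseteq> U" "card T = r" "\<forall>x\<in>T. \<forall>y\<in>T. x \<noteq> y \<longrightarrow> E x y"
        by (auto simp: cliques_def)
      have "a \<notin> T" "finite T" using T disj fin finite_subset by auto
      then have "card S = Suc r" using T by simp
      moreover have "E a y" "E y a" if "y \<in> T" for y using that T join sym by blast+
      ultimately show ?thesis using T by (auto simp: cliques_def)
    qed
  qed
  have "cliques (Suc r) U E \<inter> ?f ` (A \<times> cliques r U E) = {}"
    using disj by (auto simp: cliques_def)
  moreover have "inj_on ?f (A \<times> cliques r U E)"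
  proof (rule inj_onI)
    fix p q assume pq: "p \<in> A \<times> cliques r U E" "q \<in> A \<times> cliques r U E" "?f p = ?f q"
    obtain a S c T where e: "p = (a, S)" "q = (c, T)" by (cases p, cases q) auto
    have i: "insert a S = insert c T" "a \<in> A" "c \<in> A" "S \<subseteq> U" "T \<subseteq> U" using pq e by (auto simp: cliques_def)
    have "insert a S \<inter> U = S" "insert c T \<inter> U = T" "insert a S \<inter> A = {a}" "insert c T \<inter> A = {c}"
      using i disj by blast+
    then have "S = T" "{a} = {c}" using i(1) by auto
    then show "p = q" using e by simp
  qed
  ultimately show ?thesis
    unfolding clique_count_cliques split
    by (simp add: card_Un_disjoint fin finite_cliques card_image card_cartesian_product)
qed

lemma clique_count_two_joins:
  assumes fin: "finite V" and sub: "A \<subseteq> V" "B \<subseteq> V" "A \<inter> B = {}"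
    and A: "\<And>x y. x \<in> A \<Longrightarrow> y \<in> V \<Longrightarrow> E x y \<longleftrightarrow> y \<notin> A"
    and B: "\<And>x y. x \<in> B \<Longrightarrow> y \<in> V \<Longrightarrow> E x y \<longleftrightarrow> y \<notin> B"
    and card: "card A = b" "card B = b" "card (V - A - B) = b + e"
    and reg: "\<And>v. v \<in> V - A - B \<Longrightarrow> card (nbr E (V - A - B) v) = e"
  shows "clique_count 3 V E = clique_count 3 (V - A - B) E + b * (b + e) ^ 2"
    and "clique_count 3 (V - A - B) E = 0 \<Longrightarrow> 2 * clique_count 4 V E = b ^ 2 * (b + e) * e"
proof -
  let ?U = "V - A - B"
  have fins: "finite A" "finite B" "finite ?U" using fin sub finite_subset by auto
  have jB: "clique_count (Suc r) (B \<union> ?U) E = clique_count (Suc r) ?U E + b * clique_count r ?U E" for r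
    unfolding card(2)[symmetric] by (rule clique_count_join) (use fins B sub in auto)
  have jA: "clique_count (Suc r) V E = clique_count (Suc r) (B \<union> ?U) E + b * clique_count r (B \<union> ?U) E" for r
  proof -
    have "V = A \<union> (B \<union> ?U)" using sub by blast
    moreover have "clique_count (Suc r) (A \<union> (B \<union> ?U)) E =
        clique_count (Suc r) (B \<union> ?U) E + card A * clique_count r (B \<union> ?U) E"
    proof (rule clique_count_join)
      show "E x y" if "x \<in> A" "y \<in> B \<union> ?U" for x y using that A[of x y] sub by blast
      show "\<not> E x y" if "x \<in> A" "y \<in> A" for x y using that A[of x y] sub by blast
    qed (use fins sub in auto)
    ultimately show ?thesis using card(1) by simp
  qed
  have k2: "2 * clique_count 2 ?U E = (b + e) * e"
    using clique_count_2[OF fins(3)] reg card(3) by simp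
  have k1: "clique_count 1 ?U E = b + e" using clique_count_1[OF fins(3)] card(3) by simp
  have s: "Suc 1 = 2" "Suc 2 = 3" "Suc 3 = 4" by simp_all
  \<comment> \<open>Peeling off \<open>A\<close> and then \<open>B\<close> leaves cliques with two,
    one or no vertices in these classes. The first two kinds number
    \<open>b * (b + e) * e + b * b * (b + e)\<close>.\<close>
  have "clique_count 3 V E = clique_count 3 ?U E + b * (2 * clique_count 2 ?U E) + b * b * clique_count 1 ?U E"
    using jA[of 2] jB[of 2] jB[of 1] unfolding s by (simp add: algebra_simps)
  then show "clique_count 3 V E = clique_count 3 ?U E + b * (b + e) ^ 2"
    unfolding k2 k1 by (simp add: power2_eq_square algebra_simps)
  assume z: "clique_count 3 ?U E = 0"
  then have z4: "clique_count 4 ?U E = 0" using clique_count_eq_0_Suc[OF fins(3), of 3] unfolding s by simp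
  have "2 * clique_count 4 V E = b * b * (2 * clique_count 2 ?U E)"
    using jA[of 3] jB[of 3] jB[of 2] z z4 unfolding s by (simp add: algebra_simps)
  then show "2 * clique_count 4 V E = b ^ 2 * (b + e) * e"
    unfolding k2 by (simp add: power2_eq_square algebra_simps)
qed

end

text \<open>A circulant graph on the integers modulo \<open>b + e\<close>. The parity condition says
  that order times degree is even.\<close>

lemma regular_graph_exists:
  fixes b e :: nat
  assumes "0 < b" "even b \<Longrightarrow> even e"
  obtains H where "simple_graph {0..<b + e} H" "\<And>v. v \<in> {0..<b + e} \<Longrightarrow> degree {0..<b + e} H v = e"
proof -
  define m where "m = b + e"
  \<comment> \<open>The distances form an interval centred at \<open>m / 2\<close>, hence closed
    under \<open>d\<close> to \<open>m - d\<close>. For even \<open>b\<close> the interval has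
    \<open>e + 1\<close> members and its midpoint is removed.\<close>
  define D where "D = {d. b \<le> 2 * d \<and> 2 * d \<le> b + 2 * e \<and> (even b \<longrightarrow> 2 * d \<noteq> m)}"
  have D_less: "0 < d" "d < m" if "d \<in> D" for d using that assms(1) unfolding D_def m_def by auto
  have D_sym: "m - d \<in> D" if "d \<in> D" for d
  proof -
    have "2 * (m - d) = 2 * b + 2 * e - 2 * d" unfolding m_def by simp
    then show ?thesis using that unfolding D_def m_def by auto
  qed
  have card_D: "card D = e"
  proof (cases "even b")
    case True
    then obtain k l where kl: "b = 2 * k" "e = 2 * l" using assms(2) by (meson evenE)
    have "D = {k..k + e} - {k + l}" unfolding D_def m_def kl by auto
    then show ?thesis using kl by simp
  next
    case False
    then obtain k where k: "b = 2 * k + 1" by (meson oddE)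
    have "D = {k + 1..k + e}" unfolding D_def m_def k by auto
    then show ?thesis by simp
  qed
  define H where "H x y \<longleftrightarrow> x < m \<and> y < m \<and> (x < y \<and> y - x \<in> D \<or> y < x \<and> x - y \<in> D)" for x y
  have "degree {0..<m} H x = e" if x: "x < m" for x
  proof -
    have "bij_betw (\<lambda>d. if x + d < m then x + d else x + d - m) D {y \<in> {0..<m}. H x y}"
    proof (rule bij_betw_byWitness[where f' = "\<lambda>y. if x < y then y - x else y + m - x"])
      show "\<forall>d\<in>D. (if x < (if x + d < m then x + d else x + d - m) then (if x + d < m then x + d else x + d - m) - x
          else (if x + d < m then x + d else x + d - m) + m - x) = d"
        using D_less x by force
      show "\<forall>y\<in>{y \<in> {0..<m}. H x y}. (if x + (if x < y then y - x else y + m - x) < m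
          then x + (if x < y then y - x else y + m - x) else x + (if x < y then y - x else y + m - x) - m) = y"
        using x unfolding H_def by auto
      show "(\<lambda>d. if x + d < m then x + d else x + d - m) ` D \<subseteq> {y \<in> {0..<m}. H x y}"
      proof (rule image_subsetI)
        fix d assume d: "d \<in> D"
        show "(if x + d < m then x + d else x + d - m) \<in> {y \<in> {0..<m}. H x y}"
        proof (cases "x + d < m")
          case True
          then show ?thesis using d D_less[OF d] x unfolding H_def by simp
        next
          case False
          then have "x - (x + d - m) = m - d" "x + d - m < x" using D_less[OF d] by auto
          then show ?thesis using False D_sym[OF d] x unfolding H_def by simp
        qed
      qed
      show "(\<lambda>y. if x < y then y - x else y + m - x) ` {y \<in> {0..<m}. H x y} \<subseteq> D"
      proof (rule image_subsetI)
        fix y assume "y \<in> {y \<in> {0..<m}. H x y}"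
        then have y: "H x y" "y < m" by auto
        have "m - (x - y) = y + m - x" if "y < x" using that x by simp
        then show "(if x < y then y - x else y + m - x) \<in> D"
          using y D_sym[of "x - y"] unfolding H_def by auto
      qed
    qed
    then show ?thesis unfolding degree_def using card_D by (simp add: bij_betw_same_card)
  qed
  moreover have "simple_graph {0..<m} H" unfolding simple_graph_def H_def by auto
  ultimately show thesis using that[of H] unfolding m_def by auto
qed

subsection \<open>The extremal family\<close>

lemma degree_nbr: "degree V E v = card (nbr E V v)"
  by (simp add: degree_def nbr_def)

lemma simple_graphD:
  assumes "simple_graph V E"
  shows "finite V" "E x y \<Longrightarrow> E y x" "\<not> E x x" "E x y \<Longrightarrow> x \<in> V \<and> y \<in> V"
  using assms by (auto simp: simple_graph_def)

context dense_graph
begin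

lemma clique_count_3_ge: "b * (b + e) ^ 2 \<le> clique_count 3 V E"
proof -
  have "6 * int (b * (b + e) ^ 2) \<le> 6 * int (clique_count 3 V E)"
    using tri_ge clique_count_3[where E=E, OF sym irrefl fin] by (simp add: mult.assoc)
  then show ?thesis by linarith
qed

lemma clique_count_4_ge: "b * e * clique_count 3 V E \<le> (b + e) * (2 * clique_count 4 V E)"
proof -
  have t: "tri E V = 6 * int (clique_count 3 V E)" and q: "quad E V = 24 * int (clique_count 4 V E)"
    using clique_count_3[where E=E, OF sym irrefl fin] clique_count_4[where E=E, OF sym irrefl fin] by simp_all
  have "12 * int (b * e * clique_count 3 V E) \<le> 12 * int ((b + e) * (2 * clique_count 4 V E))"
    using quad_ge by (simp add: t q algebra_simps)
  then show ?thesis by linarith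
qed

lemma clique_count_4_ge': "b ^ 2 * (b + e) * e \<le> 2 * clique_count 4 V E"
proof -
  have "(b + e) * (b ^ 2 * (b + e) * e) = b * e * (b * (b + e) ^ 2)"
    by (simp add: power2_eq_square algebra_simps)
  also have "\<dots> \<le> b * e * clique_count 3 V E" using clique_count_3_ge by simp
  also have "\<dots> \<le> (b + e) * (2 * clique_count 4 V E)" by (rule clique_count_4_ge)
  finally show ?thesis using e_pos by simp
qed

text \<open>Equality for 4-cliques makes the chain through \<open>clique_count_4_ge\<close> tight,
  so the structure theory for triangles covers both cases.\<close>

lemma extremal_if_clique_count_4:
  assumes "2 * clique_count 4 V E = b ^ 2 * (b + e) * e"
  shows "clique_count 3 V E = b * (b + e) ^ 2"
proof -
  have "b * e * clique_count 3 V E \<le> (b + e) * (b ^ 2 * (b + e) * e)"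
    using clique_count_4_ge unfolding assms .
  also have "\<dots> = b * e * (b * (b + e) ^ 2)"
    by (simp add: power2_eq_square algebra_simps)
  finally have "clique_count 3 V E \<le> b * (b + e) ^ 2" using e_pos e_le by simp
  then show ?thesis using clique_count_3_ge by simp
qed

lemma extremal_structure:
  assumes "clique_count 3 V E = b * (b + e) ^ 2"
  obtains A B where "A \<subseteq> V" "B \<subseteq> V" "A \<inter> B = {}" "card A = b" "card B = b" "card (V - A - B) = b + e"
    "\<And>x y. x \<in> A \<Longrightarrow> y \<in> V \<Longrightarrow> E x y \<longleftrightarrow> y \<notin> A"
    "\<And>x y. x \<in> B \<Longrightarrow> y \<in> V \<Longrightarrow> E x y \<longleftrightarrow> y \<notin> B"
    "\<And>v. v \<in> V - A - B \<Longrightarrow> card (nbr E (V - A - B) v) = e"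
    "clique_count 3 (V - A - B) E = 0" "even (card V * (2 * b + e))"
proof -
  have ext: "tri E V = 6 * int b * int (b + e) ^ 2"
    using clique_count_3[where E=E, OF sym irrefl fin] assms by simp
  obtain A B where AB: "A \<subseteq> V" "B \<subseteq> V" "A \<inter> B = {}" "card A = b" "card B = b"
    "\<And>x y. x \<in> A \<Longrightarrow> y \<in> V \<Longrightarrow> E x y \<longleftrightarrow> y \<notin> A"
    "\<And>x y. x \<in> B \<Longrightarrow> y \<in> V \<Longrightarrow> E x y \<longleftrightarrow> y \<notin> B"
    using extremal_partition[OF ext] by blast
  have fins: "finite A" "finite B" using AB fin finite_subset by auto
  have cardU: "card (V - A - B) = b + e"
  proof -
    have "card (V - (A \<union> B)) = card V - card (A \<union> B)"
      using fins AB by (intro card_Diff_subset) auto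
    moreover have "card (A \<union> B) = 2 * b" using fins AB by (simp add: card_Un_disjoint)
    ultimately show ?thesis using order by (simp add: Diff_Un set_diff_eq Int_def conj_ac)
  qed
  have reg: "card (nbr E (V - A - B) v) = e" if v: "v \<in> V - A - B" for v
  proof -
    have "N v = A \<union> B \<union> nbr E (V - A - B) v"
    proof (intro equalityI subsetI)
      fix u assume "u \<in> N v"
      then show "u \<in> A \<union> B \<union> nbr E (V - A - B) v" by (auto simp: nbr_def)
    next
      fix u assume "u \<in> A \<union> B \<union> nbr E (V - A - B) v"
      then show "u \<in> N v" using AB(1,2) AB(6)[of u v] AB(7)[of u v] v sym[of u v] by (auto simp: nbr_def)
    qed
    moreover have "card (A \<union> B \<union> nbr E (V - A - B) v) = card A + card B + card (nbr E (V - A - B) v)"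
      using fins fin AB(3) by (subst card_Un_disjoint) (auto simp: nbr_def card_Un_disjoint)
    ultimately show ?thesis using extremal_degree[OF ext, of v] v AB(4,5) by simp
  qed
  have "clique_count 3 V E = clique_count 3 (V - A - B) E + b * (b + e) ^ 2"
    using clique_count_two_joins(1)[where E=E, OF sym irrefl fin AB(1-3,6,7,4,5) cardU reg] .
  then have "clique_count 3 (V - A - B) E = 0" using assms by simp
  \<comment> \<open>The degree sum of the regular graph is even; this is the parity condition in
    \<open>family_defined\<close>.\<close>
  moreover have "2 * clique_count 2 V E = card V * (2 * b + e)"
    using clique_count_2[where E=E, OF sym irrefl fin] extremal_degree[OF ext] by simp
  then have "even (card V * (2 * b + e))" by (metis dvd_triv_left)
  ultimately show thesis using that[OF AB(1-5) cardU AB(6,7) reg] by blast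
qed

end

lemma dense_graphI:
  assumes "simple_graph V E" "card V = 3 * b + e" "0 < e" "e \<le> b" "\<And>v. v \<in> V \<Longrightarrow> 2 * b + e \<le> degree V E v"
  shows "dense_graph V E b e"
  using assms by unfold_locales (auto simp: simple_graph_def degree_nbr)

section \<open>Attainment of the minima in \<open>min_tri_regular\<close> and
  \<open>kmin\<close>\<close>

lemma finite_clique_counts:
  fixes m :: nat
  shows "finite {clique_count r {0..<m} E |E. P E}"
proof (rule finite_subset)
  show "{clique_count r {0..<m} E |E. P E} \<subseteq> {..card (Pow {0..<m})}"
    unfolding clique_count_cliques by (auto simp: cliques_def intro!: card_mono)
qed simp

lemma min_tri_regular_eq_0:
  assumes U: "simple_graph U E" "card U = m" "\<And>v. v \<in> U \<Longrightarrow> degree U E v = e" "clique_count 3 U E = 0"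
  shows "min_tri_regular m (real e) = 0"
proof -
  have finU: "finite U" using U(1) by (simp add: simple_graph_def)
  obtain f where f: "bij_betw f {0..<m} U" using ex_bij_betw_nat_finite[OF finU] U(2) by blast
  then have inj: "inj_on f {0..<m}" and im: "f ` {0..<m} = U" by (auto simp: bij_betw_def)
  define F where "F x y \<longleftrightarrow> x < m \<and> y < m \<and> E (f x) (f y)" for x y
  have "simple_graph {0..<m} F" using U(1) unfolding simple_graph_def F_def by auto
  moreover have "degree {0..<m} F v = e" if v: "v \<in> {0..<m}" for v
  proof -
    have "f ` {u \<in> {0..<m}. F v u} = {u \<in> U. E (f v) u}" using v im unfolding F_def by auto
    moreover have "card (f ` {u \<in> {0..<m}. F v u}) = card {u \<in> {0..<m}. F v u}"
      by (intro card_image inj_on_subset[OF inj]) blast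
    ultimately have "degree {0..<m} F v = degree U E (f v)" unfolding degree_def by simp
    then show ?thesis using U(3) im v by auto
  qed
  moreover have "clique_count 3 {0..<m} F = 0"
  proof -
    have "clique_count 3 {0..<m} F = clique_count 3 {0..<m} (\<lambda>x y. E (f x) (f y))"
      by (rule clique_count_cong) (auto simp: F_def)
    then show ?thesis using clique_count_image[OF inj, of 3 E] im U(4) by simp
  qed
  ultimately have "0 \<in> {clique_count 3 {0..<m} F |F. simple_graph {0..<m} F \<and> (\<forall>v\<in>{0..<m}. real (degree {0..<m} F v) = real e)}"
    by (intro CollectI exI[of _ F]) auto
  from Min_le[OF finite_clique_counts this] show ?thesis unfolding min_tri_regular_def by (simp only: le_zero_eq)
qed

text \<open>The given graph makes the set nonempty; \<open>Min\<close> of an empty set would carry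
  no information.\<close>

lemma min_tri_regular_attained:
  assumes "simple_graph {0..<m} H'" "\<And>v. v \<in> {0..<m} \<Longrightarrow> degree {0..<m} H' v = e"
  obtains H where "simple_graph {0..<m} H" "\<And>v. v \<in> {0..<m} \<Longrightarrow> degree {0..<m} H v = e"
    "clique_count 3 {0..<m} H = min_tri_regular m (real e)"
proof -
  let ?S = "{clique_count 3 {0..<m} F |F. simple_graph {0..<m} F \<and> (\<forall>v\<in>{0..<m}. real (degree {0..<m} F v) = real e)}"
  have "clique_count 3 {0..<m} H' \<in> ?S" using assms by (intro CollectI exI[of _ H']) auto
  then have "Min ?S \<in> ?S" by (intro Min_in finite_clique_counts) blast
  then obtain H where "Min ?S = clique_count 3 {0..<m} H" "simple_graph {0..<m} H"
    "\<forall>v\<in>{0..<m}. real (degree {0..<m} H v) = real e" by blast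
  then show thesis using that[of H] unfolding min_tri_regular_def by simp
qed

lemma kmin_attained:
  assumes "\<delta> < n"
  obtains E where "simple_graph {0..<n} E" "has_min_degree {0..<n} E \<delta>" "clique_count r {0..<n} E = kmin r n \<delta>"
proof -
  let ?S = "{clique_count r {0..<n} E |E. simple_graph {0..<n} E \<and> has_min_degree {0..<n} E \<delta>}"
  \<comment> \<open>A complete graph in which vertex 0 keeps only the neighbours 1 to
    \<open>\<delta>\<close>: it has degree \<open>\<delta>\<close>, and all other degrees are at
    least that.\<close>
  define E where "E x y \<longleftrightarrow> x < n \<and> y < n \<and> x \<noteq> y \<and> (x = 0 \<longrightarrow> y \<le> \<delta>) \<and> (y = 0 \<longrightarrow> x \<le> \<delta>)" for x y
  have "simple_graph {0..<n} E" unfolding simple_graph_def E_def by auto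
  moreover have "has_min_degree {0..<n} E \<delta>"
  proof -
    have "{u \<in> {0..<n}. E 0 u} = {1..\<delta>}" using assms unfolding E_def by auto
    then have d0: "degree {0..<n} E 0 = \<delta>" unfolding degree_def by simp
    moreover have "\<delta> \<le> degree {0..<n} E v" if v: "v \<in> {0..<n}" for v
    proof -
      consider "v = 0" | "0 < v" "v \<le> \<delta>" | "\<delta> < v" by linarith
      then show ?thesis
      proof cases
        case 1
        then show ?thesis using d0 by simp
      next
        case 2
        then have "{0..\<delta>} - {v} \<subseteq> {u \<in> {0..<n}. E v u}" using assms unfolding E_def by auto
        then have "card ({0..\<delta>} - {v}) \<le> degree {0..<n} E v" unfolding degree_def by (intro card_mono) auto
        then show ?thesis using 2 by simp
      next
        case 3
        then have "{1..\<delta>} \<subseteq> {u \<in> {0..<n}. E v u}" using assms v unfolding E_def by auto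
        then have "card {1..\<delta>} \<le> degree {0..<n} E v" unfolding degree_def by (intro card_mono) auto
        then show ?thesis by simp
      qed
    qed
    ultimately show ?thesis unfolding has_min_degree_def using assms by (metis atLeastLessThan_iff le0 le_less_trans)
  qed
  ultimately have "clique_count r {0..<n} E \<in> ?S" by blast
  then have "Min ?S \<in> ?S" by (intro Min_in finite_clique_counts) blast
  then obtain F where "Min ?S = clique_count r {0..<n} F" "simple_graph {0..<n} F" "has_min_degree {0..<n} F \<delta>"
    by blast
  then show thesis using that[of F] unfolding kmin_def by simp
qed

lemma kmin_le:
  assumes "simple_graph {0..<n} E" "has_min_degree {0..<n} E \<delta>"
  shows "kmin r n \<delta> \<le> clique_count r {0..<n} E"
  unfolding kmin_def using assms by (intro Min_le finite_clique_counts) blast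

section \<open>Translation between \<open>b\<close>, \<open>e\<close> and \<open>n\<close>,
  \<open>\<delta>\<close>, \<open>\<beta>\<close>\<close>

locale extremal_parameters =
  fixes b e n \<delta> :: nat and \<beta> :: real
  assumes e_pos: "0 < e" and e_le: "e \<le> b" and n: "n = 3 * b + e" and \<delta>: "\<delta> = 2 * b + e"
    and \<beta>: "\<beta> = real b / real n"
begin

lemma n_pos: "0 < n" using n e_pos by simp

lemma \<beta>_n: "\<beta> * real n = real b" using n_pos by (simp add: \<beta>)

lemma pp_eq: "pp \<beta> = 3"
proof -
  have "1 / \<beta> = 3 + real e / real b" using e_pos e_le by (simp add: \<beta> n add_divide_distrib)
  moreover have "real e / real b \<le> 1" "0 < real e / real b" using e_pos e_le by simp_all
  ultimately have "1 / \<beta> \<le> 4" "3 < 1 / \<beta>" by linarith+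
  then have "\<lceil>1 / \<beta>\<rceil> = 4" by (intro ceiling_unique) auto
  then show ?thesis by (simp add: pp_def)
qed

lemma part_sizes:
  "(1 - of_int (3 - 1) * \<beta>) * real n = real (b + e)" "(1 - of_int 3 * \<beta>) * real n = real e"
  using \<beta>_n by (simp_all add: algebra_simps n)

text \<open>The exponent \<open>r - 2\<close> truncates to 0 here, but its coefficient is a binomial
  with negative lower entry, hence 0.\<close>

lemma g_1: "g 1 \<beta> * real n ^ 1 = real n"
  by (simp add: g_def pp_eq binom_def algebra_simps)

lemma g_2: "g 2 \<beta> * real n ^ 2 = real n * real \<delta> / 2"
proof -
  have d: "(1 - \<beta>) * real n = real \<delta>" using \<beta>_n by (simp add: algebra_simps n \<delta>)
  have "g 2 \<beta> = (1 - \<beta>) / 2"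
    by (simp add: g_def pp_eq binom_def power2_eq_square field_simps)
  then have "g 2 \<beta> * real n ^ 2 = real n * ((1 - \<beta>) * real n) / 2" by (simp add: power2_eq_square)
  then show ?thesis unfolding d .
qed

lemma g_3: "g 3 \<beta> * real n ^ 3 = real (b * (b + e) ^ 2)"
proof -
  have "g 3 \<beta> = \<beta> * (1 - 2 * \<beta>) ^ 2"
    by (simp add: g_def pp_eq binom_def power2_eq_square field_simps)
  then have "g 3 \<beta> * real n ^ 3 = (\<beta> * real n) * ((1 - of_int (3 - 1) * \<beta>) * real n) ^ 2"
    by (simp add: power2_eq_square power3_eq_cube)
  then show ?thesis unfolding \<beta>_n part_sizes by simp
qed

lemma g_4: "g 4 \<beta> * real n ^ 4 = real (b ^ 2 * (b + e) * e) / 2"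
proof -
  have "g 4 \<beta> = (1 - 3 * \<beta>) * (1 - 2 * \<beta>) * \<beta> ^ 2 / 2"
    by (simp add: g_def pp_eq binom_def)
  then have "g 4 \<beta> * real n ^ 4 =
      (\<beta> * real n) ^ 2 * ((1 - of_int (3 - 1) * \<beta>) * real n) * ((1 - of_int 3 * \<beta>) * real n) / 2"
    by (simp add: power2_eq_square power4_eq_xxxx)
  then show ?thesis unfolding \<beta>_n part_sizes by simp
qed

text \<open>All three binomials have upper entry 2 and lower entry at least 3.\<close>

lemma g_ge_5: "5 \<le> r \<Longrightarrow> g r \<beta> = 0"
  by (simp add: g_def pp_eq binom_def)

lemma family_defined_iff: "family_defined n \<beta> \<longleftrightarrow> \<not> (odd n \<and> odd \<delta>)"
proof -
  have d: "(1 - \<beta>) * real n = real \<delta>" using \<beta>_n by (simp add: algebra_simps n \<delta>)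
  have "0 < \<delta>" using \<delta> e_pos by simp
  then show ?thesis unfolding family_defined_def d of_nat_eq_iff using n_pos by auto
qed

lemma family_partition_iff:
  "family_partition n \<beta> V E part \<longleftrightarrow>
     (\<forall>v\<in>V. part v < 3) \<and> card {v \<in> V. part v = 0} = b + e
   \<and> card {v \<in> V. part v = 1} = b \<and> card {v \<in> V. part v = 2} = b
   \<and> (\<forall>u\<in>V. \<forall>v\<in>V. part u \<noteq> part v \<longrightarrow> E u v)
   \<and> (\<forall>u\<in>V. \<forall>v\<in>V. part u = part v \<and> 1 \<le> part u \<longrightarrow> \<not> E u v)
   \<and> (\<forall>v\<in>{v \<in> V. part v = 0}. degree {v \<in> V. part v = 0} E v = e)
   \<and> clique_count 3 {v \<in> V. part v = 0} E = min_tri_regular (card {v \<in> V. part v = 0}) (real e)"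
proof -
  have i: "(\<forall>i. 1 \<le> int i \<and> int i \<le> 3 - 1 \<longrightarrow> P i) \<longleftrightarrow> P 1 \<and> P 2" for P :: "nat \<Rightarrow> bool"
  proof
    assume "P 1 \<and> P 2"
    moreover have "i = 1 \<or> i = 2" if "1 \<le> int i \<and> int i \<le> 3 - 1" for i using that by linarith
    ultimately show "\<forall>i. 1 \<le> int i \<and> int i \<le> 3 - 1 \<longrightarrow> P i" by blast
  qed auto
  have three: "int k < 3 \<longleftrightarrow> k < 3" for k by linarith
  show ?thesis
    unfolding family_partition_def Let_def pp_eq part_sizes \<beta>_n i three of_nat_eq_iff
    by (rule iffI) (elim conjE, intro conjI, assumption+)+
qed

lemma family_partition_triangles:
  assumes "family_partition n \<beta> V E part"
  shows "clique_count 3 {v \<in> V. part v = 0} E = min_tri_regular (b + e) (real e)"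
proof -
  have "card {v \<in> V. part v = 0} = b + e"
    "clique_count 3 {v \<in> V. part v = 0} E = min_tri_regular (card {v \<in> V. part v = 0}) (real e)"
    using assms unfolding family_partition_iff by blast+
  then show ?thesis by (simp only:)
qed

lemma partition_parts:
  assumes V: "simple_graph V E" and P: "family_partition n \<beta> V E part"
  shows "clique_count 3 V E = clique_count 3 {v \<in> V. part v = 0} E + b * (b + e) ^ 2"
    and "clique_count 3 {v \<in> V. part v = 0} E = 0 \<Longrightarrow> 2 * clique_count 4 V E = b ^ 2 * (b + e) * e"
proof -
  define A B where "A = {v \<in> V. part v = 1}" and "B = {v \<in> V. part v = 2}"
  have P': "\<forall>v\<in>V. part v < 3" "card {v \<in> V. part v = 0} = b + e" "card A = b" "card B = b"
    "\<forall>u\<in>V. \<forall>v\<in>V. part u \<noteq> part v \<longrightarrow> E u v"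
    "\<forall>u\<in>V. \<forall>v\<in>V. part u = part v \<and> 1 \<le> part u \<longrightarrow> \<not> E u v"
    "\<forall>v\<in>{v \<in> V. part v = 0}. degree {v \<in> V. part v = 0} E v = e"
    using P unfolding family_partition_iff A_def B_def by blast+
  have "part v = 0 \<or> part v = 1 \<or> part v = 2" if "v \<in> V" for v using P'(1) that by force
  then have U: "{v \<in> V. part v = 0} = V - A - B" unfolding A_def B_def by force
  have AB: "A \<subseteq> V" "B \<subseteq> V" "A \<inter> B = {}" unfolding A_def B_def by auto
  have joinA: "E x y \<longleftrightarrow> y \<notin> A" if "x \<in> A" "y \<in> V" for x y
    using P'(5,6) that unfolding A_def by (cases "part y = 1") auto
  have joinB: "E x y \<longleftrightarrow> y \<notin> B" if "x \<in> B" "y \<in> V" for x y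
    using P'(5,6) that unfolding B_def by (cases "part y = 2") auto
  have reg: "card (nbr E (V - A - B) v) = e" if "v \<in> V - A - B" for v
    using P'(7) that unfolding U degree_nbr by blast
  have size: "card (V - A - B) = b + e" using P'(2) unfolding U .
  note J = clique_count_two_joins[where E=E, OF simple_graphD(2)[OF V] simple_graphD(3)[OF V]
      simple_graphD(1)[OF V] AB joinA joinB P'(3,4) size reg]
  show "clique_count 3 V E = clique_count 3 {v \<in> V. part v = 0} E + b * (b + e) ^ 2"
    unfolding U by (rule J(1))
  show "2 * clique_count 4 V E = b ^ 2 * (b + e) * e" if "clique_count 3 {v \<in> V. part v = 0} E = 0"
    using that unfolding U by (intro J(2))
qed

lemma extremal_in_partition:
  assumes V: "simple_graph V E" "card V = n" "\<And>v. v \<in> V \<Longrightarrow> \<delta> \<le> degree V E v"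
    and eq: "clique_count 3 V E = b * (b + e) ^ 2"
  obtains part where "family_partition n \<beta> V E part" "family_defined n \<beta>" "min_tri_regular (b + e) (real e) = 0"
proof -
  interpret dense_graph V E b e
    using V e_pos e_le n \<delta> by (intro dense_graphI) auto
  obtain A B where AB: "A \<subseteq> V" "B \<subseteq> V" "A \<inter> B = {}" "card A = b" "card B = b" "card (V - A - B) = b + e"
    "\<And>x y. x \<in> A \<Longrightarrow> y \<in> V \<Longrightarrow> E x y \<longleftrightarrow> y \<notin> A"
    "\<And>x y. x \<in> B \<Longrightarrow> y \<in> V \<Longrightarrow> E x y \<longleftrightarrow> y \<notin> B"
    "\<And>v. v \<in> V - A - B \<Longrightarrow> card (nbr E (V - A - B) v) = e"
    "clique_count 3 (V - A - B) E = 0" "even (card V * (2 * b + e))"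
    using extremal_structure[OF eq] by blast
  define part where "part v = (if v \<in> A then 1 else if v \<in> B then 2 else 0 :: nat)" for v
  have parts: "{v \<in> V. part v = 0} = V - A - B" "{v \<in> V. part v = 1} = A" "{v \<in> V. part v = 2} = B"
    using AB(1-3) unfolding part_def by auto
  \<comment> \<open>The relation is cut down to the remaining vertices because
    \<open>simple_graph\<close> demands that all edges lie inside the vertex set.\<close>
  have "simple_graph (V - A - B) (\<lambda>x y. x \<in> V - A - B \<and> y \<in> V - A - B \<and> E x y)"
    using V(1) unfolding simple_graph_def by auto
  moreover have "degree (V - A - B) (\<lambda>x y. x \<in> V - A - B \<and> y \<in> V - A - B \<and> E x y) v = e" if "v \<in> V - A - B" for v
  proof -
    have "{u \<in> V - A - B. v \<in> V - A - B \<and> u \<in> V - A - B \<and> E v u} = nbr E (V - A - B) v"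
      using that unfolding nbr_def by auto
    then show ?thesis using AB(9)[OF that] unfolding degree_def by simp
  qed
  moreover have "clique_count 3 (V - A - B) (\<lambda>x y. x \<in> V - A - B \<and> y \<in> V - A - B \<and> E x y) = 0"
    using AB(10) clique_count_cong[of "V - A - B" E "\<lambda>x y. x \<in> V - A - B \<and> y \<in> V - A - B \<and> E x y" 3] by simp
  ultimately have mt: "min_tri_regular (b + e) (real e) = 0"
    using min_tri_regular_eq_0 AB(6) by blast
  have "E u v" if "u \<in> V" "v \<in> V" "part u \<noteq> part v" for u v
    using that AB(7)[of u v] AB(8)[of u v] AB(7)[of v u] AB(8)[of v u] sym[of v u]
    unfolding part_def by (auto split: if_splits)
  moreover have "\<not> E u v" if "u \<in> V" "v \<in> V" "part u = part v" "1 \<le> part u" for u v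
    using that AB(7)[of u v] AB(8)[of u v] unfolding part_def by (auto split: if_splits)
  moreover have "part v < 3" for v unfolding part_def by simp
  ultimately have "family_partition n \<beta> V E part"
    unfolding family_partition_iff parts using AB mt by (auto simp: degree_nbr)
  moreover have "family_defined n \<beta>" using AB(11) V(2) \<delta> unfolding family_defined_iff by simp
  ultimately show thesis using that mt by blast
qed

lemma family_graph_exists:
  assumes "family_defined n \<beta>"
  obtains E part where "simple_graph {0..<n} E" "has_min_degree {0..<n} E \<delta>" "family_partition n \<beta> {0..<n} E part"
proof -
  \<comment> \<open>Even \<open>b\<close> with odd \<open>e\<close> would make both \<open>n\<close>
    and \<open>\<delta>\<close> odd.\<close>
  have "even b \<Longrightarrow> even e" using assms n \<delta> unfolding family_defined_iff by auto
  then obtain H' where "simple_graph {0..<b + e} H'" "\<And>v. v \<in> {0..<b + e} \<Longrightarrow> degree {0..<b + e} H' v = e"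
    using regular_graph_exists[of b e] e_pos e_le by auto
  then obtain H where H: "simple_graph {0..<b + e} H" "\<And>v. v \<in> {0..<b + e} \<Longrightarrow> degree {0..<b + e} H v = e"
    "clique_count 3 {0..<b + e} H = min_tri_regular (b + e) (real e)"
    using min_tri_regular_attained by metis
  define part where "part v = (if v < b + e then 0 else if v < 2 * b + e then 1 else 2 :: nat)" for v
  define E where "E x y \<longleftrightarrow> x < n \<and> y < n \<and> (part x \<noteq> part y \<or> H x y)" for x y
  have H': "H x y \<Longrightarrow> x < b + e \<and> y < b + e" "H x y \<Longrightarrow> H y x" "\<not> H x x" for x y
    using simple_graphD[OF H(1)] by auto
  have parts: "{v \<in> {0..<n}. part v = 0} = {0..<b + e}" "{v \<in> {0..<n}. part v = 1} = {b + e..<2 * b + e}"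
    "{v \<in> {0..<n}. part v = 2} = {2 * b + e..<n}"
    unfolding part_def n by auto
  have HE: "E x y \<longleftrightarrow> H x y" if "x \<in> {0..<b + e}" "y \<in> {0..<b + e}" for x y
    using that unfolding E_def part_def n by auto
  have sg: "simple_graph {0..<n} E" unfolding simple_graph_def E_def using H' by auto
  have deg0: "degree {0..<b + e} E v = e" if "v \<in> {0..<b + e}" for v
    using H(2)[OF that] HE[OF that] unfolding degree_def by (metis (no_types, lifting) Collect_cong)
  have deg: "degree {0..<n} E v = \<delta>" if v: "v \<in> {0..<n}" for v
  proof -
    have p: "part v = 0 \<or> part v = 1 \<or> part v = 2" unfolding part_def by simp
    from p consider "part v = 0" | "part v = 1" | "part v = 2" by (elim disjE) metis+
    then show ?thesis
    proof cases
      case 1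
      then have v0: "v \<in> {0..<b + e}" using v parts(1) by blast
      have "{u \<in> {0..<n}. E v u} = {u \<in> {0..<b + e}. E v u} \<union> {b + e..<n}"
        using v0 unfolding E_def part_def n by auto
      moreover have "card ({u \<in> {0..<b + e}. E v u} \<union> {b + e..<n}) = e + (n - (b + e))"
        using deg0[OF v0] unfolding degree_def by (subst card_Un_disjoint) auto
      ultimately show ?thesis unfolding degree_def using n \<delta> by simp
    next
      case 2
      then have "{u \<in> {0..<n}. E v u} = {0..<n} - {b + e..<2 * b + e}"
        using v H'(1)[of v] unfolding E_def part_def n by (auto split: if_splits)
      moreover have "card ({0..<n} - {b + e..<2 * b + e}) = n - b"
        using n by (subst card_Diff_subset) auto
      ultimately show ?thesis unfolding degree_def using n \<delta> by simp
    next
      case 3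
      then have "{u \<in> {0..<n}. E v u} = {0..<n} - {2 * b + e..<n}"
        using v H'(1)[of v] unfolding E_def part_def n by (auto split: if_splits)
      moreover have "card ({0..<n} - {2 * b + e..<n}) = n - b"
        using n by (subst card_Diff_subset) auto
      ultimately show ?thesis unfolding degree_def using n \<delta> by simp
    qed
  qed
  then have "has_min_degree {0..<n} E \<delta>" using n_pos unfolding has_min_degree_def by auto
  moreover have "family_partition n \<beta> {0..<n} E part"
  proof -
    have "clique_count 3 {0..<b + e} E = clique_count 3 {0..<b + e} H"
      by (rule clique_count_cong) (rule HE)
    moreover have "\<forall>u\<in>{0..<n}. \<forall>v\<in>{0..<n}. part u \<noteq> part v \<longrightarrow> E u v" unfolding E_def by simp
    moreover have "\<forall>u\<in>{0..<n}. \<forall>v\<in>{0..<n}. part u = part v \<and> 1 \<le> part u \<longrightarrow> \<not> E u v"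
      using H'(1) unfolding E_def part_def by fastforce
    moreover have "\<forall>v\<in>{0..<n}. part v < 3" unfolding part_def by simp
    ultimately show ?thesis unfolding family_partition_iff parts using H(3) deg0 n by simp
  qed
  ultimately show thesis using that sg by blast
qed

text \<open>Feasibility quantifies over all family graphs on \<open>{0..<n}\<close>. The forward
  direction needs one to exist, as otherwise the condition would hold vacuously.\<close>

lemma feasible_iff: "feasible n \<beta> \<longleftrightarrow> family_defined n \<beta> \<and> min_tri_regular (b + e) (real e) = 0"
proof
  assume f: "feasible n \<beta>"
  then have d: "family_defined n \<beta>" by (simp add: feasible_def)
  obtain E part where "simple_graph {0..<n} E" "family_partition n \<beta> {0..<n} E part"
    using family_graph_exists[OF d] by blast
  then have "clique_count 3 {v \<in> {0..<n}. part v = 0} E = 0" "family_partition n \<beta> {0..<n} E part"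
    using f unfolding feasible_def by blast+
  then show "family_defined n \<beta> \<and> min_tri_regular (b + e) (real e) = 0"
    using d family_partition_triangles by metis
next
  assume "family_defined n \<beta> \<and> min_tri_regular (b + e) (real e) = 0"
  then show "feasible n \<beta>" unfolding feasible_def using family_partition_triangles by metis
qed

lemma clique_count_ge_g:
  assumes V: "simple_graph V E" "card V = n" "\<And>v. v \<in> V \<Longrightarrow> \<delta> \<le> degree V E v" and r: "0 < r"
  shows "g r \<beta> * real n ^ r \<le> real (clique_count r V E)"
proof -
  interpret dense_graph V E b e
    using V e_pos e_le n \<delta> by (intro dense_graphI) auto
  consider "r = 1" | "r = 2" | "r = 3" | "r = 4" | "5 \<le> r" using r by linarith
  then show ?thesis
  proof cases
    case 1
    have "clique_count 1 V E = n" using clique_count_1[where E=E, OF sym irrefl fin] V(2) by simp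
    then show ?thesis unfolding 1 g_1 by simp
  next
    case 2
    have "n * \<delta> \<le> (\<Sum>v\<in>V. card (nbr E V v))"
      using sum_mono[of V "\<lambda>_. \<delta>" "\<lambda>v. card (nbr E V v)"] V(2,3) by (simp add: degree_nbr)
    also have "\<dots> = 2 * clique_count 2 V E" by (rule clique_count_2[where E=E, OF sym irrefl fin, symmetric])
    finally have "real n * real \<delta> \<le> 2 * real (clique_count 2 V E)"
      by (metis of_nat_le_iff of_nat_mult of_nat_numeral)
    then show ?thesis using g_2 2 by simp
  next
    case 3
    show ?thesis unfolding 3 g_3 of_nat_le_iff by (rule clique_count_3_ge)
  next
    case 4
    have "real (b ^ 2 * (b + e) * e) \<le> real (2 * clique_count 4 V E)"
      using clique_count_4_ge' unfolding of_nat_le_iff .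
    then show ?thesis unfolding 4 g_4 by simp
  next
    case 5
    then show ?thesis by (simp add: g_ge_5)
  qed
qed

lemma extremal_if_eq_g:
  assumes V: "simple_graph V E" "card V = n" "\<And>v. v \<in> V \<Longrightarrow> \<delta> \<le> degree V E v" and r: "r \<in> {3, 4}"
    and eq: "real (clique_count r V E) = g r \<beta> * real n ^ r"
  shows "feasible n \<beta> \<and> in_family n \<beta> V E"
proof -
  interpret dense_graph V E b e
    using V e_pos e_le n \<delta> by (intro dense_graphI) auto
  have "clique_count 3 V E = b * (b + e) ^ 2"
  proof (cases "r = 3")
    case True
    then show ?thesis using eq unfolding True g_3 of_nat_eq_iff by simp
  next
    case False
    then have "r = 4" using r by simp
    then have "real (2 * clique_count 4 V E) = real (b ^ 2 * (b + e) * e)"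
      using eq g_4 by simp
    then show ?thesis unfolding of_nat_eq_iff by (rule extremal_if_clique_count_4)
  qed
  then show ?thesis
    using extremal_in_partition[OF V] V(1,2) unfolding feasible_iff in_family_def by metis
qed

lemma family_clique_count:
  assumes f: "feasible n \<beta>" and V: "simple_graph V E" and P: "family_partition n \<beta> V E part" and r: "r \<in> {3, 4}"
  shows "real (clique_count r V E) = g r \<beta> * real n ^ r"
proof -
  have z: "clique_count 3 {v \<in> V. part v = 0} E = 0"
    using f family_partition_triangles[OF P] unfolding feasible_iff by simp
  show ?thesis
  proof (cases "r = 3")
    case True
    then show ?thesis unfolding True g_3 using partition_parts(1)[OF V P] z by simp
  next
    case False
    then have "r = 4" using r by simp
    moreover have "real (2 * clique_count 4 V E) = real (b ^ 2 * (b + e) * e)"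
      using partition_parts(2)[OF V P z] by simp
    ultimately show ?thesis using g_4 by simp
  qed
qed

end

theorem mainTheorem3:
  fixes n \<delta> :: nat and \<beta> :: real
  assumes "0 < n" and "0 < \<delta>"
    and "2 * n < 3 * \<delta>" and "4 * \<delta> \<le> 3 * n"
    and "\<beta> = 1 - real \<delta> / real n"
  shows "(\<forall>r::nat. 0 < r \<longrightarrow> real (kmin r n \<delta>) \<ge> g r \<beta> * real n ^ r)
    \<and> (\<forall>r::nat. r \<in> {3, 4} \<longrightarrow>
         (real (kmin r n \<delta>) = g r \<beta> * real n ^ r \<longleftrightarrow> feasible n \<beta>)
       \<and> (feasible n \<beta> \<longrightarrow>
           (\<forall>(V :: 'a set) E. simple_graph V E \<and> card V = n \<and> has_min_degree V E \<delta> \<longrightarrow>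
              (real (clique_count r V E) = g r \<beta> * real n ^ r \<longleftrightarrow> in_family n \<beta> V E))))"
proof -
  have less: "\<delta> < n" using assms by linarith
  \<comment> \<open>The hypotheses keep both natural subtractions from truncating, and
    \<open>4 * \<delta> \<le> 3 * n\<close> becomes \<open>e \<le> b\<close>.\<close>
  interpret extremal_parameters "n - \<delta>" "3 * \<delta> - 2 * n" n \<delta> \<beta>
    using assms less by unfold_locales (auto simp: of_nat_diff field_simps)
  have lower: "g r \<beta> * real n ^ r \<le> real (kmin r n \<delta>)" if r: "0 < r" for r
  proof -
    obtain E where E: "simple_graph {0..<n} E" "has_min_degree {0..<n} E \<delta>" "clique_count r {0..<n} E = kmin r n \<delta>"
      by (rule kmin_attained[OF less])
    show ?thesis
      using clique_count_ge_g[OF E(1) _ _ r] E(2) unfolding E(3) has_min_degree_def by simp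
  qed
  have equality: "real (kmin r n \<delta>) = g r \<beta> * real n ^ r \<longleftrightarrow> feasible n \<beta>" if r: "r \<in> {3, 4}" for r
  proof
    assume eq: "real (kmin r n \<delta>) = g r \<beta> * real n ^ r"
    obtain E where E: "simple_graph {0..<n} E" "has_min_degree {0..<n} E \<delta>" "clique_count r {0..<n} E = kmin r n \<delta>"
      by (rule kmin_attained[OF less])
    show "feasible n \<beta>"
      using extremal_if_eq_g[OF E(1) _ _ r] E(2) eq unfolding E(3) has_min_degree_def by simp
  next
    assume f: "feasible n \<beta>"
    then obtain E part where E: "simple_graph {0..<n} E" "has_min_degree {0..<n} E \<delta>" "family_partition n \<beta> {0..<n} E part"
      using family_graph_exists unfolding feasible_def by blast
    have "real (kmin r n \<delta>) \<le> g r \<beta> * real n ^ r"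
      using kmin_le[OF E(1,2), of r] family_clique_count[OF f E(1,3) r] by (metis of_nat_le_iff)
    then show "real (kmin r n \<delta>) = g r \<beta> * real n ^ r" using lower[of r] r by auto
  qed
  have family: "real (clique_count r V E) = g r \<beta> * real n ^ r \<longleftrightarrow> in_family n \<beta> V E"
    if r: "r \<in> {3, 4}" and f: "feasible n \<beta>" and V: "simple_graph V E" "card V = n" "has_min_degree V E \<delta>"
    for r and V :: "'a set" and E
  proof
    assume "real (clique_count r V E) = g r \<beta> * real n ^ r"
    then show "in_family n \<beta> V E"
      using extremal_if_eq_g[OF V(1,2) _ r] V(3) unfolding has_min_degree_def by blast
  next
    assume "in_family n \<beta> V E"
    then show "real (clique_count r V E) = g r \<beta> * real n ^ r"
      using family_clique_count[OF f V(1) _ r] unfolding in_family_def by blast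
  qed
  show ?thesis using lower equality family by blast
qed

end
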